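(* Let $\epsilon>0$ and $\delta\in(0,1)$. Consider the algorithm EPRL (described in the context) run with parameters $(\epsilon,\delta)$ and an arbitrary sampling rule, on deterministic MDPs with $\sigma^2$-sub-Gaussian rewards. If the sampling rule makes EPRL stop almost surely, then EPRL is $(\epsilon,\delta)$-PAC, i.e. the returned policy $\widehat\pi$ satisfies $\mathbb{P}_{\mathcal{M}}\big(V_1^{\widehat\pi}(s_1)\ge V_1^\star(s_1)-\epsilon\big)\ge 1-\delta$ for every such MDP $\mathcal{M}$.
   Context: Deterministic MDP. $\mathcal{M}=(\mathcal{S},\mathcal{A},\{f_h,\nu_h\}_{h\in[H]},s_1,H)$, $[H]=\{1,\dots,H\}$, where $\mathcal{S},\mathcal{A}$ are finite, $f_h:\mathcal{S}\times\mathcal{A}\to\mathcal{S}$ is the (deterministic) transition function at stage $h$, $\nu_h(s,a)$ is the reward distribution on $\mathbb{R}$ with mean $r_h(s,a)$, $s_1$ is the initial state. At stage $h$ in state $s$ only actions in $\mathcal{A}_h(s)\subseteq\mathcal{A}$ are available. $\Pi$ is the (non-empty) set of deterministic policies $\pi=(\pi_h)_{h\in[H]}$, $\pi_h:\mathcal{S}\to\mathcal{A}$, $\pi_h(s)\in\mathcal{A}_h(s)$. Playing $\pi$ gives $s_1^\pi=s_1$, $a_h^\pi=\pi_h(s_h^\pi)$, $s_{h+1}^\pi=f_h(s_h^\pi,a_h^\pi)$. $\mathcal{S}_h=\{s:\exists\pi\in\Pi,s_h^\pi=s\}$; $N=\sum_{h=1}^H\sum_{s\in\mathcal{S}_h}|\mathcal{A}_h(s)|$;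 $\Pi_{s,a,h}=\{\pi\in\Pi:s_h^\pi=s,a_h^\pi=a\}$. $V_1^\pi(s_1)=\sum_{h=1}^Hr_h(s_h^\pi,a_h^\pi)$, $V_1^\star(s_1)=\max_{\pi\in\Pi}V_1^\pi(s_1)$. Learning protocol. Everything except the reward distributions is known. In episode $t=1,2,\dots$ the learner selects $\pi^t\in\Pi$ from past observations (sampling rule), and observes the trajectory $(s_h^t,a_h^t)=(s_h^{\pi^t},a_h^{\pi^t})$ and independent rewards $y_h^t\sim\nu_h(s_h^t,a_h^t)$. Rewards are $\sigma^2$-sub-Gaussian with known $\sigma^2$. The stopping time is denoted $\tau$. EPRL. Let $n_h^t(s,a)=\sum_{l=1}^t\mathbf{1}\{s_h^l=s,a_h^l=a\}$, $\hat r_h^t(s,a)=\frac{1}{n_h^t(s,a)}\sum_{l=1}^ty_h^l\mathbf{1}\{s_h^l=s,a_h^l=a\}$ ($0$ if no visit), $b_h^t(s,a)=\sqrt{\beta(n_h^t(s,a),\delta)/n_h^t(s,a)}$ ($+\infty$ if $n_h^t(s,a)=0$), with $\beta(n,\delta)=2\sigma^2\log(4n^2N/\delta)$. For $\pi\in\Pi$ let $\overline V_1^{t,\pi}(s_1)=\sum_{h=1}^H(\hat r_h^t+b_h^t)(s_h^\pi,a_h^\pi)$ and $\underline V_1^{t,\pi}(s_1)=\sum_{h=1}^H(\hat r_h^t-b_h^t)(s_h^\pi,a_h^\pi)$. Initialize $\mathcal{A}_h^0(s)=\mathcal{A}_h(s)$ for $h\in[H],s\in\mathcal{S}_h$. Let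 $\Pi^t=\{\pi\in\Pi:\forall s,h,\ \pi_h(s)\in\mathcal{A}_h^t(s)\text{ or }\mathcal{A}_h^t(s)=\emptyset\}$. In each episode $t\ge1$: (i) play $\pi^t$ given by the sampling rule; (ii) update $n_h^t,\hat r_h^t$; (iii) set $\mathcal{A}_h^t(s)=\mathcal{A}_h^{t-1}(s)\cap\{a\in\mathcal{A}:\max_{\pi\in\Pi_{s,a,h}\cap\Pi^{t-1}}\overline V_1^{t,\pi}(s_1)\ge\max_{\pi\in\Pi}\underline V_1^{t,\pi}(s_1)\}$ (if $\Pi_{s,a,h}\cap\Pi^{t-1}=\emptyset$, the action is eliminated); (iv) if $\max_{\pi\in\Pi^t}2\sum_{h=1}^Hb_h^t(s_h^\pi,a_h^\pi)\le\epsilon$, or $|\mathcal{A}_h^t(s)|\le1$ for all $h\in[H],s\in\mathcal{S}_h$, stop ($\tau=t$) and return some $\widehat\pi\in\arg\max_{\pi\in\Pi^t}\overline V_1^{t,\pi}(s_1)$. *)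

theory Defs
  imports "HOL-Probability.Probability"
begin

section \<open>Deterministic MDPs\<close>

text \<open>Stages are \<open>1, ..., horizon\<close>; the components of a record at other stages are never used.
  The state and action sets are types of class \<open>finite\<close>.\<close>

record ('s, 'a) det_mdp =
  transition :: "nat \<Rightarrow> 's \<Rightarrow> 'a \<Rightarrow> 's"
  reward :: "nat \<Rightarrow> 's \<Rightarrow> 'a \<Rightarrow> real measure"
  avail :: "nat \<Rightarrow> 's \<Rightarrow> 'a set"
  init :: 's
  horizon :: nat

type_synonym ('s, 'a) policy = "nat \<Rightarrow> 's \<Rightarrow> 'a"

text \<open>Policies are extensional outside the stages of the MDP, so that there are only finitely
  many of them.\<close>

definition policies :: "('s::finite, 'a::finite) det_mdp \<Rightarrow> ('s, 'a) policy set" where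
  "policies M = (\<Pi>\<^sub>E h\<in>{1..horizon M}. \<Pi>\<^sub>E s\<in>UNIV. avail M h s)"

text \<open>The value at index \<open>0\<close> is a dummy; the trajectory starts at stage \<open>1\<close>.\<close>

primrec state_at :: "('s::finite, 'a::finite) det_mdp \<Rightarrow> ('s, 'a) policy \<Rightarrow> nat \<Rightarrow> 's" where
  "state_at M \<pi> 0 = init M"
| "state_at M \<pi> (Suc h) =
     (if h = 0 then init M
      else transition M h (state_at M \<pi> h) (\<pi> h (state_at M \<pi> h)))"

definition action_at :: "('s::finite, 'a::finite) det_mdp \<Rightarrow> ('s, 'a) policy \<Rightarrow> nat \<Rightarrow> 'a" where
  "action_at M \<pi> h = \<pi> h (state_at M \<pi> h)"

definition reachable :: "('s::finite, 'a::finite) det_mdp \<Rightarrow> nat \<Rightarrow> 's set" where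
  "reachable M h = {s. \<exists>\<pi>\<in>policies M. state_at M \<pi> h = s}"

definition num_triples :: "('s::finite, 'a::finite) det_mdp \<Rightarrow> nat" where
  "num_triples M = (\<Sum>h = 1..horizon M. \<Sum>s\<in>reachable M h. card (avail M h s))"

definition policies_through ::
  "('s::finite, 'a::finite) det_mdp \<Rightarrow> 's \<Rightarrow> 'a \<Rightarrow> nat \<Rightarrow> ('s, 'a) policy set" where
  "policies_through M s a h =
     {\<pi>\<in>policies M. state_at M \<pi> h = s \<and> action_at M \<pi> h = a}"

definition mean_reward :: "('s::finite, 'a::finite) det_mdp \<Rightarrow> nat \<Rightarrow> 's \<Rightarrow> 'a \<Rightarrow> real" where
  "mean_reward M h s a = (\<integral>x. x \<partial>reward M h s a)"

definition policy_value :: "('s::finite, 'a::finite) det_mdp \<Rightarrow> ('s, 'a) policy \<Rightarrow> real" where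
  "policy_value M \<pi> =
     (\<Sum>h = 1..horizon M. mean_reward M h (state_at M \<pi> h) (action_at M \<pi> h))"

definition optimal_value :: "('s::finite, 'a::finite) det_mdp \<Rightarrow> real" where
  "optimal_value M = Max (policy_value M ` policies M)"

definition sub_gaussian :: "real \<Rightarrow> real measure \<Rightarrow> bool" where
  "sub_gaussian \<sigma> D \<longleftrightarrow>
     real_distribution D \<and> integrable D (\<lambda>x. x) \<and>
     (\<forall>l. integrable D (\<lambda>x. exp (l * (x - (\<integral>z. z \<partial>D)))) \<and>
          (\<integral>x. exp (l * (x - (\<integral>z. z \<partial>D))) \<partial>D) \<le> exp (\<sigma>\<^sup>2 * l\<^sup>2 / 2))"

definition sub_gaussian_mdp :: "real \<Rightarrow> ('s::finite, 'a::finite) det_mdp \<Rightarrow> bool" where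
  "sub_gaussian_mdp \<sigma> M \<longleftrightarrow>
     policies M \<noteq> {} \<and>
     (\<forall>h\<in>{1..horizon M}. \<forall>s. \<forall>a\<in>avail M h s. sub_gaussian \<sigma> (reward M h s a))"


section \<open>The learning protocol\<close>

text \<open>\<open>pol t\<close> is the policy played in episode \<open>t \<ge> 1\<close> and \<open>y t h\<close> the reward observed at stage
  \<open>h\<close> of that episode. \<open>F t\<close> is the information available after \<open>t\<close> episodes: it contains the
  observations, and may be larger, so that the sampling rule may also use internal
  randomization. A sampling rule enters as the predictable process \<open>pol\<close> that it generates.
  The last clause says that, given \<open>F (t - 1)\<close> (which determines \<open>pol t\<close>), the rewards of episode
  \<open>t\<close> are independent and follow the reward distributions along the trajectory of \<open>pol t\<close>.
  The process goes on for ever; stopping is modelled by a random time.\<close>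

definition learning_protocol ::
  "('s::finite, 'a::finite) det_mdp \<Rightarrow> 'w measure \<Rightarrow> (nat \<Rightarrow> 'w measure) \<Rightarrow>
   (nat \<Rightarrow> 'w \<Rightarrow> ('s, 'a) policy) \<Rightarrow> (nat \<Rightarrow> nat \<Rightarrow> 'w \<Rightarrow> real) \<Rightarrow> bool" where
  "learning_protocol M P F pol y \<longleftrightarrow>
     prob_space P \<and> filtration (space P) F \<and> (\<forall>t. subalgebra P (F t)) \<and>
     (\<forall>t\<ge>1. pol t \<in> measurable (F (t - 1)) (count_space (policies M))) \<and>
     (\<forall>t\<ge>1. \<forall>h\<in>{1..horizon M}. y t h \<in> borel_measurable (F t)) \<and>
     (\<forall>t\<ge>1. \<forall>\<pi>\<in>policies M. \<forall>E\<in>sets (F (t - 1)). \<forall>B.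
        (\<forall>h\<in>{1..horizon M}. B h \<in> sets borel) \<longrightarrow>
        measure P {\<omega>\<in>E. pol t \<omega> = \<pi> \<and> (\<forall>h\<in>{1..horizon M}. y t h \<omega> \<in> B h)} =
        measure P {\<omega>\<in>E. pol t \<omega> = \<pi>} *
          (\<Prod>h = 1..horizon M.
             measure (reward M h (state_at M \<pi> h) (action_at M \<pi> h)) (B h)))"


section \<open>EPRL\<close>

text \<open>The quantities computed by the algorithm are functions of the observed data: \<open>p l\<close> is the
  policy played in episode \<open>l\<close>, and \<open>y l h\<close> the reward observed at stage \<open>h\<close> of episode \<open>l\<close>.\<close>

definition visits ::
  "('s::finite, 'a::finite) det_mdp \<Rightarrow> (nat \<Rightarrow> ('s, 'a) policy) \<Rightarrow>
   nat \<Rightarrow> nat \<Rightarrow> 's \<Rightarrow> 'a \<Rightarrow> nat" where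
  "visits M p t h s a =
     card {l\<in>{1..t}. state_at M (p l) h = s \<and> action_at M (p l) h = a}"

text \<open>Division by zero gives the value \<open>0\<close> when there was no visit.\<close>

definition emp_mean ::
  "('s::finite, 'a::finite) det_mdp \<Rightarrow> (nat \<Rightarrow> ('s, 'a) policy) \<Rightarrow> (nat \<Rightarrow> nat \<Rightarrow> real) \<Rightarrow>
   nat \<Rightarrow> nat \<Rightarrow> 's \<Rightarrow> 'a \<Rightarrow> real" where
  "emp_mean M p y t h s a =
     (\<Sum>l | l \<in> {1..t} \<and> state_at M (p l) h = s \<and> action_at M (p l) h = a. y l h)
       / real (visits M p t h s a)"

definition beta_threshold ::
  "('s::finite, 'a::finite) det_mdp \<Rightarrow> real \<Rightarrow> real \<Rightarrow> nat \<Rightarrow> real" where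
  "beta_threshold M \<sigma> \<delta> n =
     2 * \<sigma>\<^sup>2 * ln (4 * (real n)\<^sup>2 * real (num_triples M) / \<delta>)"

definition bonus ::
  "('s::finite, 'a::finite) det_mdp \<Rightarrow> real \<Rightarrow> real \<Rightarrow> (nat \<Rightarrow> ('s, 'a) policy) \<Rightarrow>
   nat \<Rightarrow> nat \<Rightarrow> 's \<Rightarrow> 'a \<Rightarrow> ereal" where
  "bonus M \<sigma> \<delta> p t h s a =
     (let n = visits M p t h s a in
      if n = 0 then \<infinity> else ereal (sqrt (beta_threshold M \<sigma> \<delta> n / real n)))"

definition upper_value ::
  "('s::finite, 'a::finite) det_mdp \<Rightarrow> real \<Rightarrow> real \<Rightarrow> (nat \<Rightarrow> ('s, 'a) policy) \<Rightarrow>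
   (nat \<Rightarrow> nat \<Rightarrow> real) \<Rightarrow> nat \<Rightarrow> ('s, 'a) policy \<Rightarrow> ereal" where
  "upper_value M \<sigma> \<delta> p y t \<pi> =
     (\<Sum>h = 1..horizon M.
        ereal (emp_mean M p y t h (state_at M \<pi> h) (action_at M \<pi> h))
        + bonus M \<sigma> \<delta> p t h (state_at M \<pi> h) (action_at M \<pi> h))"

definition lower_value ::
  "('s::finite, 'a::finite) det_mdp \<Rightarrow> real \<Rightarrow> real \<Rightarrow> (nat \<Rightarrow> ('s, 'a) policy) \<Rightarrow>
   (nat \<Rightarrow> nat \<Rightarrow> real) \<Rightarrow> nat \<Rightarrow> ('s, 'a) policy \<Rightarrow> ereal" where
  "lower_value M \<sigma> \<delta> p y t \<pi> =
     (\<Sum>h = 1..horizon M.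
        ereal (emp_mean M p y t h (state_at M \<pi> h) (action_at M \<pi> h))
        - bonus M \<sigma> \<delta> p t h (state_at M \<pi> h) (action_at M \<pi> h))"

text \<open>The policies compatible with a family \<open>A\<close> of sets of active actions.\<close>

definition compatible_policies ::
  "('s::finite, 'a::finite) det_mdp \<Rightarrow> (nat \<Rightarrow> 's \<Rightarrow> 'a set) \<Rightarrow> ('s, 'a) policy set" where
  "compatible_policies M A =
     {\<pi>\<in>policies M. \<forall>h\<in>{1..horizon M}. \<forall>s\<in>reachable M h. \<pi> h s \<in> A h s \<or> A h s = {}}"

text \<open>\<open>Max\<close> is unspecified on the empty set, so elimination of an action through which no
  remaining policy passes is a separate condition.\<close>

primrec active ::
  "('s::finite, 'a::finite) det_mdp \<Rightarrow> real \<Rightarrow> real \<Rightarrow> (nat \<Rightarrow> ('s, 'a) policy) \<Rightarrow>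
   (nat \<Rightarrow> nat \<Rightarrow> real) \<Rightarrow> nat \<Rightarrow> nat \<Rightarrow> 's \<Rightarrow> 'a set" where
  "active M \<sigma> \<delta> p y 0 = avail M"
| "active M \<sigma> \<delta> p y (Suc t) = (\<lambda>h s. active M \<sigma> \<delta> p y t h s \<inter>
     {a. let Q = policies_through M s a h \<inter> compatible_policies M (active M \<sigma> \<delta> p y t) in
         Q \<noteq> {} \<and>
         Max (upper_value M \<sigma> \<delta> p y (Suc t) ` Q)
           \<ge> Max (lower_value M \<sigma> \<delta> p y (Suc t) ` policies M)})"

definition remaining_policies ::
  "('s::finite, 'a::finite) det_mdp \<Rightarrow> real \<Rightarrow> real \<Rightarrow> (nat \<Rightarrow> ('s, 'a) policy) \<Rightarrow>
   (nat \<Rightarrow> nat \<Rightarrow> real) \<Rightarrow> nat \<Rightarrow> ('s, 'a) policy set" where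
  "remaining_policies M \<sigma> \<delta> p y t = compatible_policies M (active M \<sigma> \<delta> p y t)"

definition stop_condition ::
  "('s::finite, 'a::finite) det_mdp \<Rightarrow> real \<Rightarrow> real \<Rightarrow> real \<Rightarrow> (nat \<Rightarrow> ('s, 'a) policy) \<Rightarrow>
   (nat \<Rightarrow> nat \<Rightarrow> real) \<Rightarrow> nat \<Rightarrow> bool" where
  "stop_condition M \<sigma> \<epsilon> \<delta> p y t \<longleftrightarrow>
     Max ((\<lambda>\<pi>. 2 * (\<Sum>h = 1..horizon M.
                bonus M \<sigma> \<delta> p t h (state_at M \<pi> h) (action_at M \<pi> h)))
          ` remaining_policies M \<sigma> \<delta> p y t) \<le> ereal \<epsilon> \<or>
     (\<forall>h\<in>{1..horizon M}. \<forall>s\<in>reachable M h. card (active M \<sigma> \<delta> p y t h s) \<le> 1)"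

text \<open>The stopping time is infinite if the algorithm never stops.\<close>

definition stopping_episode ::
  "('s::finite, 'a::finite) det_mdp \<Rightarrow> real \<Rightarrow> real \<Rightarrow> real \<Rightarrow> (nat \<Rightarrow> ('s, 'a) policy) \<Rightarrow>
   (nat \<Rightarrow> nat \<Rightarrow> real) \<Rightarrow> enat" where
  "stopping_episode M \<sigma> \<epsilon> \<delta> p y =
     Inf (enat ` {t. 1 \<le> t \<and> stop_condition M \<sigma> \<epsilon> \<delta> p y t})"

text \<open>A policy that the algorithm may return when it stops after episode \<open>t\<close>.\<close>

definition valid_output ::
  "('s::finite, 'a::finite) det_mdp \<Rightarrow> real \<Rightarrow> real \<Rightarrow> (nat \<Rightarrow> ('s, 'a) policy) \<Rightarrow>
   (nat \<Rightarrow> nat \<Rightarrow> real) \<Rightarrow> nat \<Rightarrow> ('s, 'a) policy \<Rightarrow> bool" where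
  "valid_output M \<sigma> \<delta> p y t \<pi> \<longleftrightarrow>
     is_arg_max (upper_value M \<sigma> \<delta> p y t) (\<lambda>\<pi>'. \<pi>' \<in> remaining_policies M \<sigma> \<delta> p y t) \<pi>"

end

theory Submission
  imports Defs
begin

text \<open>With probability at least \<open>1 - \<delta>\<close> all estimates \<open>emp_mean\<close> are within their \<open>bonus\<close> of the mean
  rewards, simultaneously for all times. Indeed, for a fixed triple \<open>(h, s, a)\<close> and a fixed number \<open>n\<close>
  of visits, the exponential supermartingale of the centred rewards, stopped at the \<open>n\<close>-th visit,
  gives a failure probability of at most \<open>2 exp (- ln (4 n\<^sup>2 N / \<delta>)) = \<delta> / (2 n\<^sup>2 N)\<close>, and these sum to
  at most \<open>\<delta>\<close> over \<open>n \<ge> 1\<close> and the \<open>N\<close> triples.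

  On this event, the actions along the trajectory of an optimal policy are never eliminated. If the
  algorithm stops because each active set has at most one element, the output therefore follows the
  optimal trajectory. If it stops because twice the bonuses of each remaining policy sum to at most
  \<open>\<epsilon>\<close>, then the upper value of the output is at least the optimal value and exceeds its true value
  by at most \<open>\<epsilon>\<close>.\<close>

section \<open>Concentration of sums of sub-Gaussian increments collected at predictable
  times\<close>

text \<open>The assumption \<open>mgf\<close> is the conditional moment bound given
  \<open>F t\<close>, integrated over events of \<open>F t\<close> so that no conditional
  expectation is formed. It is required only inside \<open>D (Suc t)\<close>, the predictable event
  on which the next increment counts.\<close>

locale sub_gaussian_increments = prob_space P for P :: "'w measure" +
  fixes F :: "nat \<Rightarrow> 'w measure"
    and D :: "nat \<Rightarrow> 'w set" and X :: "nat \<Rightarrow> 'w \<Rightarrow> real" and \<sigma> :: real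
  assumes filtr: "filtration (space P) F"
    and subalg: "subalgebra P (F t)"
    and D_predictable: "D (Suc t) \<in> sets (F t)"
    and X_adapted: "X (Suc t) \<in> borel_measurable (F (Suc t))"
    and mgf: "E \<in> sets (F t) \<Longrightarrow> E \<subseteq> D (Suc t) \<Longrightarrow>
      (\<integral>\<^sup>+\<omega>. indicator E \<omega> * ennreal (exp (l * X (Suc t) \<omega>)) \<partial>P)
        \<le> ennreal (exp (\<sigma>\<^sup>2 * l\<^sup>2 / 2)) * emeasure P E"
begin

definition hits :: "nat \<Rightarrow> 'w \<Rightarrow> nat" where
  "hits t \<omega> = card {i\<in>{1..t}. \<omega> \<in> D i}"

definition total :: "nat \<Rightarrow> 'w \<Rightarrow> real" where
  "total t \<omega> = (\<Sum>i | i \<in> {1..t} \<and> \<omega> \<in> D i. X i \<omega>)"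

lemma hits_0 [simp]: "hits 0 \<omega> = 0"
  and total_0 [simp]: "total 0 \<omega> = 0"
  by (simp_all add: hits_def total_def)

lemma index_set_Suc:
  "{i\<in>{1..Suc t}. \<omega> \<in> D i} =
    (if \<omega> \<in> D (Suc t) then insert (Suc t) {i\<in>{1..t}. \<omega> \<in> D i} else {i\<in>{1..t}. \<omega> \<in> D i})"
  by (auto simp: le_Suc_eq)

lemma hits_Suc: "hits (Suc t) \<omega> = hits t \<omega> + (if \<omega> \<in> D (Suc t) then 1 else 0)"
  unfolding hits_def index_set_Suc by auto

lemma total_Suc: "total (Suc t) \<omega> = total t \<omega> + (if \<omega> \<in> D (Suc t) then X (Suc t) \<omega> else 0)"
  using index_set_Suc[of t \<omega>] unfolding total_def by auto

lemma hits_mono: "s \<le> t \<Longrightarrow> hits s \<omega> \<le> hits t \<omega>"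
  unfolding hits_def by (auto intro!: card_mono)

lemma measurable_F_mono: "s \<le> t \<Longrightarrow> f \<in> measurable (F s) N \<Longrightarrow> f \<in> measurable (F t) N"
proof -
  assume "s \<le> t" "f \<in> measurable (F s) N"
  moreover have "subalgebra (F t) (F s)"
    using \<open>s \<le> t\<close> filtration.sets_F_mono[OF filtr] filtration.space_F[OF filtr]
    by (simp add: subalgebra_def)
  ultimately show ?thesis by (rule_tac measurable_from_subalg)
qed

lemma sets_F_P: "A \<in> sets (F t) \<Longrightarrow> A \<in> sets P"
  using subalg[of t] unfolding subalgebra_def by auto

lemma measurable_F_P: "f \<in> measurable (F t) N \<Longrightarrow> f \<in> measurable P N"
  using measurable_from_subalg[OF subalg] .

lemma D_adapted: "D (Suc t) \<in> sets (F (Suc t))"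
  using filtration.sets_F_mono[OF filtr, of t "Suc t"] D_predictable by auto

lemma hits_measurable: "hits t \<in> measurable (F t) (count_space UNIV)"
proof (induction t)
  case 0
  have "hits 0 = (\<lambda>_. 0)" by auto
  then show ?case by simp
next
  case (Suc t)
  have [measurable]: "hits t \<in> measurable (F (Suc t)) (count_space UNIV)"
    "D (Suc t) \<in> sets (F (Suc t))"
    using Suc measurable_F_mono[of t "Suc t"] D_adapted by auto
  show ?case unfolding hits_Suc[abs_def] by measurable
qed

lemma total_measurable: "total t \<in> borel_measurable (F t)"
proof (induction t)
  case 0
  have "total 0 = (\<lambda>_. 0)" by auto
  then show ?case by simp
next
  case (Suc t)
  have [measurable]: "total t \<in> borel_measurable (F (Suc t))"
    "D (Suc t) \<in> sets (F (Suc t))" "X (Suc t) \<in> borel_measurable (F (Suc t))"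
    using Suc measurable_F_mono[of t "Suc t"] D_adapted X_adapted by auto
  show ?case unfolding total_Suc[abs_def] by measurable
qed

text \<open>Plays the role of pulling a known factor out of a conditional expectation. By
  \<open>mgf\<close>, the measure with the exponential as density on \<open>K\<close> is dominated
  on \<open>F t\<close> by \<open>P\<close> restricted to \<open>K\<close>, and domination passes to
  integrals of nonnegative \<open>F t\<close>-measurable functions.\<close>

lemma mgf_weighted:
  assumes K: "K \<in> sets (F t)" "K \<subseteq> D (Suc t)" and u: "u \<in> borel_measurable (F t)"
  shows "(\<integral>\<^sup>+\<omega>. indicator K \<omega> * ennreal (exp (l * X (Suc t) \<omega> - \<sigma>\<^sup>2 * l\<^sup>2 / 2)) * u \<omega> \<partial>P)
    \<le> (\<integral>\<^sup>+\<omega>. indicator K \<omega> * u \<omega> \<partial>P)"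
proof -
  define W where "W \<omega> = indicator K \<omega> * ennreal (exp (l * X (Suc t) \<omega> - \<sigma>\<^sup>2 * l\<^sup>2 / 2))" for \<omega>
  have [measurable]: "K \<in> sets P" "X (Suc t) \<in> borel_measurable P" "u \<in> borel_measurable P"
    using K sets_F_P X_adapted measurable_F_P u by blast+
  have W[measurable]: "W \<in> borel_measurable P" unfolding W_def by measurable
  \<comment> \<open>Pushing a measure forward along the identity restricts it to the
    sub-sigma-algebra \<open>F t\<close>; the domination holds only there.\<close>
  have id: "(\<lambda>\<omega>. \<omega>) \<in> measurable P (F t)"
    using subalg[of t] unfolding subalgebra_def by (auto intro!: measurableI dest: sets.sets_into_space)
  let ?N1 = "distr (density P W) (F t) (\<lambda>\<omega>. \<omega>)"
  let ?N2 = "distr (density P (indicator K)) (F t) (\<lambda>\<omega>. \<omega>)"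
  have "?N1 \<le> ?N2"
  proof (subst le_measure, simp, safe)
    fix E assume "E \<in> sets ?N1"
    then have E: "E \<in> sets (F t)" by simp
    then have [measurable]: "E \<in> sets P" by (rule sets_F_P)
    have EK: "K \<inter> E \<in> sets (F t)" "K \<inter> E \<subseteq> D (Suc t)" using E K by auto
    have sp: "E \<inter> space P = E" using \<open>E \<in> sets P\<close> sets.sets_into_space by auto
    have "emeasure ?N1 E = (\<integral>\<^sup>+\<omega>. W \<omega> * indicator E \<omega> \<partial>P)"
      using id E by (simp add: emeasure_distr emeasure_density sp)
    also have "\<dots> = (\<integral>\<^sup>+\<omega>. ennreal (exp (- (\<sigma>\<^sup>2 * l\<^sup>2 / 2))) *
        (indicator (K \<inter> E) \<omega> * ennreal (exp (l * X (Suc t) \<omega>))) \<partial>P)"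
      unfolding W_def
      by (intro nn_integral_cong)
        (auto simp: indicator_def ennreal_mult'[symmetric] exp_add[symmetric])
    also have "\<dots> = ennreal (exp (- (\<sigma>\<^sup>2 * l\<^sup>2 / 2))) *
        (\<integral>\<^sup>+\<omega>. indicator (K \<inter> E) \<omega> * ennreal (exp (l * X (Suc t) \<omega>)) \<partial>P)"
      by (intro nn_integral_cmult) measurable
    also have "\<dots> \<le> ennreal (exp (- (\<sigma>\<^sup>2 * l\<^sup>2 / 2))) *
        (ennreal (exp (\<sigma>\<^sup>2 * l\<^sup>2 / 2)) * emeasure P (K \<inter> E))"
      by (intro mult_left_mono mgf EK) simp
    also have "\<dots> = emeasure P (K \<inter> E)"
      by (simp add: mult.assoc[symmetric] ennreal_mult'[symmetric] exp_add[symmetric])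
    also have "\<dots> = emeasure ?N2 E"
      using id E by (simp add: emeasure_distr emeasure_density sp indicator_inter_arith[symmetric])
    finally show "emeasure ?N1 E \<le> emeasure ?N2 E" .
  qed
  then have "(\<integral>\<^sup>+\<omega>. u \<omega> \<partial>?N1) \<le> (\<integral>\<^sup>+\<omega>. u \<omega> \<partial>?N2)"
    by (intro nn_integral_mono_measure) auto
  moreover have "(\<integral>\<^sup>+\<omega>. u \<omega> \<partial>?N1) = (\<integral>\<^sup>+\<omega>. W \<omega> * u \<omega> \<partial>P)"
    using id u by (simp add: nn_integral_distr nn_integral_density)
  moreover have "(\<integral>\<^sup>+\<omega>. u \<omega> \<partial>?N2) = (\<integral>\<^sup>+\<omega>. indicator K \<omega> * u \<omega> \<partial>P)"
    using id u by (simp add: nn_integral_distr nn_integral_density)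
  ultimately show ?thesis unfolding W_def by simp
qed

text \<open>Since the process is frozen after the \<open>n\<close>-th hit, its value at a fixed late time still records
  the value at the \<open>n\<close>-th hit, so that Markov's inequality at one time replaces optional stopping.\<close>

primrec frozen_exp :: "nat \<Rightarrow> real \<Rightarrow> nat \<Rightarrow> 'w \<Rightarrow> real" where
  "frozen_exp n l 0 \<omega> = 1"
| "frozen_exp n l (Suc t) \<omega> = frozen_exp n l t \<omega> *
     (if \<omega> \<in> D (Suc t) \<and> hits t \<omega> < n then exp (l * X (Suc t) \<omega> - \<sigma>\<^sup>2 * l\<^sup>2 / 2) else 1)"

lemma frozen_exp_pos: "0 < frozen_exp n l t \<omega>"
  by (induction t) auto

text \<open>If there are at most \<open>n\<close> hits up to time \<open>t\<close>, each of them
  occurred when fewer than \<open>n\<close> preceded it, so no factor has been skipped.\<close>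

lemma frozen_exp_eq:
  "hits t \<omega> \<le> n \<Longrightarrow> frozen_exp n l t \<omega> = exp (l * total t \<omega> - hits t \<omega> * (\<sigma>\<^sup>2 * l\<^sup>2 / 2))"
proof (induction t)
  case (Suc t)
  then have "hits t \<omega> \<le> n" using hits_Suc[of t \<omega>] by auto
  with Suc show ?case
    by (auto simp: hits_Suc total_Suc exp_add[symmetric] algebra_simps split: if_splits)
qed simp

lemma frozen_exp_const: "hits t \<omega> \<ge> n \<Longrightarrow> t \<le> s \<Longrightarrow> frozen_exp n l s \<omega> = frozen_exp n l t \<omega>"
proof (induction s)
  case (Suc s)
  show ?case
  proof (cases "t = Suc s")
    case False
    then have "hits s \<omega> \<ge> n" "t \<le> s" using Suc hits_mono[of t s \<omega>] by auto
    with Suc show ?thesis by auto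
  qed simp
qed simp

lemma frozen_exp_measurable: "frozen_exp n l t \<in> borel_measurable (F t)"
proof (induction t)
  case 0
  have "frozen_exp n l 0 = (\<lambda>_. 1)" by auto
  then show ?case by simp
next
  case (Suc t)
  have [measurable]: "frozen_exp n l t \<in> borel_measurable (F (Suc t))"
    "D (Suc t) \<in> sets (F (Suc t))" "X (Suc t) \<in> borel_measurable (F (Suc t))"
    "hits t \<in> measurable (F (Suc t)) (count_space UNIV)"
    using measurable_F_mono[of t "Suc t", OF _ Suc] D_adapted X_adapted
      measurable_F_mono[of t "Suc t", OF _ hits_measurable] by simp_all
  have "frozen_exp n l (Suc t) = (\<lambda>\<omega>. frozen_exp n l t \<omega> *
     (if \<omega> \<in> D (Suc t) \<and> hits t \<omega> < n then exp (l * X (Suc t) \<omega> - \<sigma>\<^sup>2 * l\<^sup>2 / 2) else 1))"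
    by auto
  then show ?case by simp
qed

text \<open>The supermartingale property: a step either leaves the process unchanged or multiplies
  it by a factor of conditional mean at most 1.\<close>

lemma frozen_exp_expectation: "(\<integral>\<^sup>+\<omega>. ennreal (frozen_exp n l t \<omega>) \<partial>P) \<le> 1"
proof (induction t)
  case 0
  then show ?case by (simp add: emeasure_space_1)
next
  case (Suc t)
  let ?f = "\<lambda>\<omega>. ennreal (frozen_exp n l t \<omega>)"
  let ?e = "\<lambda>\<omega>. ennreal (exp (l * X (Suc t) \<omega> - \<sigma>\<^sup>2 * l\<^sup>2 / 2))"
  \<comment> \<open>The event that a new factor enters. It belongs to \<open>F t\<close>, since both
    the next hit and the current count are known at time \<open>t\<close>.\<close>
  define K where "K = D (Suc t) \<inter> {\<omega>\<in>space (F t). hits t \<omega> < n}"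
  have sp: "space (F t) = space P" using filtration.space_F[OF filtr] .
  have [measurable]: "hits t \<in> measurable (F t) (count_space UNIV)" "D (Suc t) \<in> sets (F t)"
    using hits_measurable D_predictable by auto
  have K: "K \<in> sets (F t)" "K \<subseteq> D (Suc t)" unfolding K_def by auto
  have uF: "?f \<in> borel_measurable (F t)" using frozen_exp_measurable by measurable
  have [measurable]: "K \<in> sets P" "X (Suc t) \<in> borel_measurable P" "?f \<in> borel_measurable P"
    using K sets_F_P X_adapted measurable_F_P uF by blast+
  have "(\<integral>\<^sup>+\<omega>. ennreal (frozen_exp n l (Suc t) \<omega>) \<partial>P)
      = (\<integral>\<^sup>+\<omega>. indicator K \<omega> * ?e \<omega> * ?f \<omega> + indicator (space P - K) \<omega> * ?f \<omega> \<partial>P)"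
    by (intro nn_integral_cong)
      (use frozen_exp_pos in \<open>auto simp: K_def sp indicator_def ennreal_mult'' mult.commute less_imp_le\<close>)
  also have "\<dots> = (\<integral>\<^sup>+\<omega>. indicator K \<omega> * ?e \<omega> * ?f \<omega> \<partial>P) + (\<integral>\<^sup>+\<omega>. indicator (space P - K) \<omega> * ?f \<omega> \<partial>P)"
    by (intro nn_integral_add) measurable
  also have "\<dots> \<le> (\<integral>\<^sup>+\<omega>. indicator K \<omega> * ?f \<omega> \<partial>P) + (\<integral>\<^sup>+\<omega>. indicator (space P - K) \<omega> * ?f \<omega> \<partial>P)"
    by (intro add_right_mono mgf_weighted K uF)
  also have "\<dots> = (\<integral>\<^sup>+\<omega>. indicator K \<omega> * ?f \<omega> + indicator (space P - K) \<omega> * ?f \<omega> \<partial>P)"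
    by (intro nn_integral_add[symmetric]) measurable
  also have "\<dots> = (\<integral>\<^sup>+\<omega>. ?f \<omega> \<partial>P)"
    by (intro nn_integral_cong) (auto simp: indicator_def)
  finally show ?case using Suc by simp
qed

text \<open>Chernoff's method: on this event \<open>frozen_exp n l T\<close> is at least
  \<open>exp L\<close> for a suitable \<open>l\<close>, while its expectation is at most 1. The
  proxy \<open>s\<close> is positive even if \<open>\<sigma> = 0\<close>, so one may divide by
  it.\<close>

lemma tail_bound_finite:
  assumes s: "\<bar>\<sigma>\<bar> < s" and n: "n > 0" and L: "L > 0"
  shows "prob {\<omega>\<in>space P. \<exists>t\<le>T. hits t \<omega> = n \<and> total t \<omega> \<ge> s * sqrt (2 * real n * L)} \<le> exp (- L)"
proof -
  define x where "x = sqrt (2 * real n * L)"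
  \<comment> \<open>This \<open>l\<close> minimizes
    \<open>n * s\<^sup>2 * l\<^sup>2 / 2 - l * s * x\<close>, and the minimum is \<open>- L\<close>
    by the choice of \<open>x\<close>.\<close>
  define l where "l = x / (n * s)"
  have s0: "s > 0" using s by auto
  have x2: "x * x = 2 * n * L" using n L by (simp add: x_def)
  have l0: "l \<ge> 0" using n L s0 by (simp add: l_def x_def)
  have "\<sigma>\<^sup>2 \<le> s\<^sup>2" using s by (simp add: abs_le_square_iff[symmetric])
  then have le: "n * (\<sigma>\<^sup>2 * l\<^sup>2 / 2) \<le> n * (s\<^sup>2 * l\<^sup>2 / 2)"
    by (intro mult_left_mono divide_right_mono mult_right_mono) auto
  have e1: "l * (s * x) = 2 * L" using n s0 x2 by (simp add: l_def field_simps)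
  have e2: "n * (s\<^sup>2 * l\<^sup>2 / 2) = L"
    using n s0 x2 by (simp add: l_def field_simps power2_eq_square)
  have [measurable]: "hits t \<in> measurable P (count_space UNIV)" "total t \<in> borel_measurable P"
     "frozen_exp n l t \<in> borel_measurable P" for t
    using hits_measurable total_measurable frozen_exp_measurable measurable_F_P by blast+
  let ?A = "{\<omega>\<in>space P. \<exists>t\<le>T. hits t \<omega> = n \<and> total t \<omega> \<ge> s * sqrt (2 * real n * L)}"
  have sub: "?A \<subseteq> {\<omega>\<in>space P. 1 \<le> ennreal (exp (- L)) * ennreal (frozen_exp n l T \<omega>)}"
  proof safe
    fix \<omega> t assume t: "t \<le> T" "n = hits t \<omega>" "total t \<omega> \<ge> s * sqrt (2 * real (hits t \<omega>) * L)"
    have "frozen_exp n l T \<omega> = frozen_exp n l t \<omega>"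
      using t by (intro frozen_exp_const) auto
    also have "\<dots> = exp (l * total t \<omega> - n * (\<sigma>\<^sup>2 * l\<^sup>2 / 2))"
      using t by (subst frozen_exp_eq) auto
    also have "\<dots> \<ge> exp L"
    proof -
      have "l * (s * x) \<le> l * total t \<omega>" using t l0 by (intro mult_left_mono) (auto simp: x_def)
      then show ?thesis using le e1 e2 by simp
    qed
    finally have "exp (- L) * exp L \<le> exp (- L) * frozen_exp n l T \<omega>" by simp
    then have "1 \<le> exp (- L) * frozen_exp n l T \<omega>" by (simp add: exp_add[symmetric])
    then show "1 \<le> ennreal (exp (- L)) * ennreal (frozen_exp (hits t \<omega>) l T \<omega>)"
      using t(2) by (simp add: ennreal_mult'[symmetric] ennreal_1[symmetric] ennreal_leI del: ennreal_1)
  qed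
  have "emeasure P ?A \<le> emeasure P {\<omega>\<in>space P. 1 \<le> ennreal (exp (- L)) * ennreal (frozen_exp n l T \<omega>)}"
    by (intro emeasure_mono sub) measurable
  also have "\<dots> \<le> ennreal (exp (- L)) * (\<integral>\<^sup>+\<omega>. ennreal (frozen_exp n l T \<omega>) * indicator (space P) \<omega> \<partial>P)"
    by (intro nn_integral_Markov_inequality) auto
  also have "(\<integral>\<^sup>+\<omega>. ennreal (frozen_exp n l T \<omega>) * indicator (space P) \<omega> \<partial>P)
      = (\<integral>\<^sup>+\<omega>. ennreal (frozen_exp n l T \<omega>) \<partial>P)"
    by (intro nn_integral_cong) auto
  also have "ennreal (exp (- L)) * \<dots> \<le> ennreal (exp (- L)) * 1"
    by (intro mult_left_mono frozen_exp_expectation) auto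
  finally show ?thesis by (simp add: emeasure_eq_measure)
qed

text \<open>Enlarging the proxy to \<open>\<bar>\<sigma>\<bar> + 1 / (k + 1)\<close> and letting \<open>k\<close> tend to infinity gives a strict
  inequality that remains meaningful in the degenerate case \<open>\<sigma> = 0\<close>.\<close>

lemma tail_bound:
  assumes n: "n > 0" and L: "L > 0"
  shows "prob {\<omega>\<in>space P. \<exists>t. hits t \<omega> = n \<and> total t \<omega> > \<bar>\<sigma>\<bar> * sqrt (2 * real n * L)} \<le> exp (- L)"
proof -
  define x where "x = sqrt (2 * real n * L)"
  have x: "x > 0" using n L by (simp add: x_def)
  define A where "A k = {\<omega>\<in>space P. \<exists>t\<le>k. hits t \<omega> = n \<and> total t \<omega> \<ge> (\<bar>\<sigma>\<bar> + 1 / real (Suc k)) * x}" for k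
  have [measurable]: "hits t \<in> measurable P (count_space UNIV)" "total t \<in> borel_measurable P" for t
    using hits_measurable total_measurable measurable_F_P by blast+
  have A[measurable]: "A k \<in> sets P" for k unfolding A_def by measurable
  have bound: "prob (A k) \<le> exp (- L)" for k
    unfolding A_def x_def by (intro tail_bound_finite n L) auto
  have "incseq A"
  proof (intro incseq_SucI subsetI)
    fix k \<omega> assume "\<omega> \<in> A k"
    then obtain t where t: "\<omega> \<in> space P" "t \<le> k" "hits t \<omega> = n"
      "(\<bar>\<sigma>\<bar> + 1 / real (Suc k)) * x \<le> total t \<omega>"
      unfolding A_def by blast
    have "(\<bar>\<sigma>\<bar> + 1 / real (Suc (Suc k))) * x \<le> (\<bar>\<sigma>\<bar> + 1 / real (Suc k)) * x"
      using x by (intro mult_right_mono add_left_mono frac_le) auto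
    with t(4) have "(\<bar>\<sigma>\<bar> + 1 / real (Suc (Suc k))) * x \<le> total t \<omega>" by linarith
    with t show "\<omega> \<in> A (Suc k)" unfolding A_def using le_SucI by blast
  qed
  then have lim: "(\<lambda>k. prob (A k)) \<longlonglongrightarrow> prob (\<Union>k. A k)"
    using A by (intro finite_Lim_measure_incseq) auto
  have "{\<omega>\<in>space P. \<exists>t. hits t \<omega> = n \<and> total t \<omega> > \<bar>\<sigma>\<bar> * sqrt (2 * real n * L)} \<subseteq> (\<Union>k. A k)"
  proof safe
    fix \<omega> t assume w: "\<omega> \<in> space P" "n = hits t \<omega>" "\<bar>\<sigma>\<bar> * sqrt (2 * real (hits t \<omega>) * L) < total t \<omega>"
    then have "0 < (total t \<omega> - \<bar>\<sigma>\<bar> * x) / x" using x by (simp add: x_def)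
    \<comment> \<open>The strict excess over \<open>\<bar>\<sigma>\<bar> * x\<close> leaves room for
      the enlargement \<open>x / (k + 1)\<close>; passing to \<open>max k t\<close> also brings
      \<open>t\<close> within the time range.\<close>
    then obtain k where k: "inverse (real (Suc k)) < (total t \<omega> - \<bar>\<sigma>\<bar> * x) / x"
      using reals_Archimedean by blast
    have "(\<bar>\<sigma>\<bar> + 1 / real (Suc (max k t))) * x \<le> (\<bar>\<sigma>\<bar> + 1 / real (Suc k)) * x"
      using x by (intro mult_right_mono add_left_mono frac_le) auto
    also have "\<dots> \<le> total t \<omega>" using k x by (simp add: field_simps)
    finally have "\<omega> \<in> A (max k t)"
      using w unfolding A_def by (auto intro!: exI[of _ t])
    then show "\<omega> \<in> (\<Union>k. A k)" by blast
  qed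
  then have "prob {\<omega>\<in>space P. \<exists>t. hits t \<omega> = n \<and> total t \<omega> > \<bar>\<sigma>\<bar> * sqrt (2 * real n * L)} \<le> prob (\<Union>k. A k)"
    by (intro finite_measure_mono) auto
  also have "\<dots> \<le> exp (- L)"
    using LIMSEQ_le_const2[OF lim] bound by auto
  finally show ?thesis .
qed

text \<open>The negated increments satisfy the same assumptions, because \<open>mgf\<close> holds
  for every real \<open>l\<close> of either sign. The factor 2 comes from adding the two one-sided
  bounds.\<close>

lemma tail_bound_two_sided:
  assumes n: "n > 0" and L: "L > 0"
  shows "{\<omega>\<in>space P. \<exists>t. hits t \<omega> = n \<and> \<bar>total t \<omega>\<bar> > \<bar>\<sigma>\<bar> * sqrt (2 * real n * L)} \<in> sets P" (is ?m)
    and "prob {\<omega>\<in>space P. \<exists>t. hits t \<omega> = n \<and> \<bar>total t \<omega>\<bar> > \<bar>\<sigma>\<bar> * sqrt (2 * real n * L)} \<le> 2 * exp (- L)" (is ?p)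
proof -
  have [measurable]: "hits t \<in> measurable P (count_space UNIV)" "total t \<in> borel_measurable P" for t
    using hits_measurable total_measurable measurable_F_P by blast+
  show ?m by measurable
  interpret neg: sub_gaussian_increments P F D "\<lambda>t \<omega>. - X t \<omega>" \<sigma>
  proof (intro sub_gaussian_increments.intro sub_gaussian_increments_axioms.intro)
    show "(\<integral>\<^sup>+\<omega>. indicator E \<omega> * ennreal (exp (l * - X (Suc t) \<omega>)) \<partial>P)
        \<le> ennreal (exp (\<sigma>\<^sup>2 * l\<^sup>2 / 2)) * emeasure P E"
      if "E \<in> sets (F t)" "E \<subseteq> D (Suc t)" for E t l
      using mgf[OF that, of "- l"] by simp
    show "(\<lambda>\<omega>. - X (Suc t) \<omega>) \<in> borel_measurable (F (Suc t))" for t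
      using X_adapted by simp
  qed (rule prob_space_axioms filtr subalg D_predictable)+
  have neg_total: "neg.total t \<omega> = - total t \<omega>" for t \<omega>
    unfolding total_def neg.total_def by (simp add: sum_negf)
  let ?U = "{\<omega>\<in>space P. \<exists>t. hits t \<omega> = n \<and> total t \<omega> > \<bar>\<sigma>\<bar> * sqrt (2 * real n * L)}"
  let ?V = "{\<omega>\<in>space P. \<exists>t. hits t \<omega> = n \<and> - total t \<omega> > \<bar>\<sigma>\<bar> * sqrt (2 * real n * L)}"
  have "prob {\<omega>\<in>space P. \<exists>t. hits t \<omega> = n \<and> \<bar>total t \<omega>\<bar> > \<bar>\<sigma>\<bar> * sqrt (2 * real n * L)} \<le> prob (?U \<union> ?V)"
    by (intro finite_measure_mono) (auto simp: abs_if split: if_splits)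
  also have "\<dots> \<le> prob ?U + prob ?V"
    by (intro measure_Un_le) measurable
  also have "\<dots> \<le> 2 * exp (- L)"
    using tail_bound[OF n L] neg.tail_bound[OF n L] unfolding neg_total neg.hits_def hits_def by simp
  finally show ?p .
qed

end

section \<open>Policies and their trajectories\<close>

lemma finite_policies [simp]: "finite (policies M)"
  unfolding policies_def by (intro finite_PiE) auto

lemma state_at_reachable: "\<pi> \<in> policies M \<Longrightarrow> state_at M \<pi> h \<in> reachable M h"
  unfolding reachable_def by blast

lemma action_at_avail:
  assumes "\<pi> \<in> policies M" "h \<in> {1..horizon M}"
  shows "action_at M \<pi> h \<in> avail M h (state_at M \<pi> h)"
  using PiE_mem[OF PiE_mem[OF assms(1)[unfolded policies_def] assms(2)]]
  unfolding action_at_def by auto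

text \<open>Agreement at the states visited by \<open>\<pi>\<close> suffices: by induction on the
  stage, \<open>\<pi>'\<close> never leaves the trajectory of \<open>\<pi>\<close>.\<close>

lemma state_at_cong:
  assumes "\<And>i. i \<in> {1..horizon M} \<Longrightarrow> \<pi>' i (state_at M \<pi> i) = \<pi> i (state_at M \<pi> i)"
    and "h \<le> horizon M"
  shows "state_at M \<pi>' h = state_at M \<pi> h"
  using assms(2)
proof (induction h)
  case (Suc h)
  then show ?case using assms(1)[of h] by (cases "h = 0") auto
qed simp

lemma action_at_cong:
  assumes "\<And>i. i \<in> {1..horizon M} \<Longrightarrow> \<pi>' i (state_at M \<pi> i) = \<pi> i (state_at M \<pi> i)"
    and "h \<in> {1..horizon M}"
  shows "action_at M \<pi>' h = action_at M \<pi> h"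
  using state_at_cong[of M \<pi>' \<pi> h, OF assms(1)] assms unfolding action_at_def by auto

section \<open>Observed rewards as sub-Gaussian increments\<close>

lemma sub_gaussian_nn_integral:
  assumes "sub_gaussian \<sigma> \<nu>"
  shows "(\<integral>\<^sup>+x. ennreal (exp (l * (x - (\<integral>z. z \<partial>\<nu>)))) \<partial>\<nu>) \<le> ennreal (exp (\<sigma>\<^sup>2 * l\<^sup>2 / 2))"
  using assms unfolding sub_gaussian_def
  by (subst nn_integral_eq_integral) (auto intro!: ennreal_leI)

locale sub_gaussian_protocol =
  fixes M :: "('s::finite, 'a::finite) det_mdp"
    and P :: "'w measure"
    and F :: "nat \<Rightarrow> 'w measure"
    and pol :: "nat \<Rightarrow> 'w \<Rightarrow> ('s, 'a) policy"
    and y :: "nat \<Rightarrow> nat \<Rightarrow> 'w \<Rightarrow> real"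
    and \<sigma> :: real
  assumes mdp: "sub_gaussian_mdp \<sigma> M"
    and protocol: "learning_protocol M P F pol y"
begin

sublocale prob_space P
  using protocol unfolding learning_protocol_def by blast

definition visited :: "nat \<Rightarrow> 's \<Rightarrow> 'a \<Rightarrow> nat \<Rightarrow> 'w set" where
  "visited h s a t =
     {\<omega>\<in>space P. state_at M (pol t \<omega>) h = s \<and> action_at M (pol t \<omega>) h = a}"

lemma filtr: "filtration (space P) F"
  and subalg: "subalgebra P (F t)"
  using protocol unfolding learning_protocol_def by blast+

lemma space_F: "space (F t) = space P"
  using filtration.space_F[OF filtr] .

lemma sets_F_P: "A \<in> sets (F t) \<Longrightarrow> A \<in> sets P"
  using subalg[of t] unfolding subalgebra_def by auto

lemma pol_predictable: "pol (Suc t) \<in> measurable (F t) (count_space (policies M))"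
proof -
  have "\<forall>t\<ge>1. pol t \<in> measurable (F (t - 1)) (count_space (policies M))"
    using protocol unfolding learning_protocol_def by blast
  from this[rule_format, of "Suc t"] show ?thesis by simp
qed

lemma pol_policies: "\<omega> \<in> space P \<Longrightarrow> pol (Suc t) \<omega> \<in> policies M"
  using measurable_space[OF pol_predictable, of \<omega> t] space_F by simp

lemma reward_adapted:
  "h \<in> {1..horizon M} \<Longrightarrow> y (Suc t) h \<in> borel_measurable (F (Suc t))"
  using protocol unfolding learning_protocol_def by (auto simp del: atLeastAtMost_iff)

lemma reward_measurable:
  "h \<in> {1..horizon M} \<Longrightarrow> y (Suc t) h \<in> borel_measurable P"
  using measurable_from_subalg[OF subalg reward_adapted] .

text \<open>Holds for an arbitrary predicate \<open>Q\<close>, since policies carry the discrete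
  sigma-algebra.\<close>

lemma pol_pred_sets: "{\<omega>\<in>space P. Q (pol (Suc t) \<omega>)} \<in> sets (F t)"
proof -
  have "pol (Suc t) -` {\<pi>\<in>policies M. Q \<pi>} \<inter> space (F t) \<in> sets (F t)"
    by (intro measurable_sets[OF pol_predictable]) auto
  also have "pol (Suc t) -` {\<pi>\<in>policies M. Q \<pi>} \<inter> space (F t) = {\<omega>\<in>space P. Q (pol (Suc t) \<omega>)}"
    using pol_policies space_F by auto
  finally show ?thesis .
qed

lemma sub_gaussian_reward:
  assumes "h \<in> {1..horizon M}" "a \<in> avail M h s"
  shows "sub_gaussian \<sigma> (reward M h s a)"
  using mdp assms unfolding sub_gaussian_mdp_def by blast

text \<open>A marginal of the product law in the protocol: the other stages receive the event
  \<open>UNIV\<close>, which has mass 1 because the rewards along a policy's trajectory are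
  probability distributions.\<close>

lemma reward_law_policy:
  assumes \<pi>: "\<pi> \<in> policies M" and E: "E \<in> sets (F t)"
    and h: "h \<in> {1..horizon M}" and B: "B \<in> sets borel"
  shows "prob {\<omega>\<in>E. pol (Suc t) \<omega> = \<pi> \<and> y (Suc t) h \<omega> \<in> B} =
    prob {\<omega>\<in>E. pol (Suc t) \<omega> = \<pi>} *
      measure (reward M h (state_at M \<pi> h) (action_at M \<pi> h)) B"
proof -
  let ?B = "\<lambda>i. if i = h then B else UNIV :: real set"
  let ?m = "\<lambda>i. measure (reward M i (state_at M \<pi> i) (action_at M \<pi> i))"
  have one: "?m i UNIV = 1" if "i \<in> {1..horizon M}" for i
  proof -
    have "real_distribution (reward M i (state_at M \<pi> i) (action_at M \<pi> i))"
      using sub_gaussian_reward[OF that action_at_avail[OF \<pi> that]]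
      unfolding sub_gaussian_def by blast
    then interpret r: real_distribution "reward M i (state_at M \<pi> i) (action_at M \<pi> i)" .
    show ?thesis using r.prob_space by simp
  qed
  have "(\<Prod>i = 1..horizon M. ?m i (?B i)) = (\<Prod>i = 1..horizon M. if i = h then ?m h B else 1)"
    using one by (intro prod.cong) auto
  also have "\<dots> = ?m h B" using h by (simp add: prod.delta)
  finally have prod: "(\<Prod>i = 1..horizon M. ?m i (?B i)) = ?m h B" .
  have "\<forall>t\<ge>1. \<forall>\<pi>\<in>policies M. \<forall>E\<in>sets (F (t - 1)). \<forall>B.
        (\<forall>h\<in>{1..horizon M}. B h \<in> sets borel) \<longrightarrow>
        prob {\<omega>\<in>E. pol t \<omega> = \<pi> \<and> (\<forall>h\<in>{1..horizon M}. y t h \<omega> \<in> B h)} =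
        prob {\<omega>\<in>E. pol t \<omega> = \<pi>} *
          (\<Prod>h = 1..horizon M.
             measure (reward M h (state_at M \<pi> h) (action_at M \<pi> h)) (B h))"
    using protocol unfolding learning_protocol_def by blast
  from this[rule_format, of "Suc t" \<pi> E ?B]
  have "prob {\<omega>\<in>E. pol (Suc t) \<omega> = \<pi> \<and> (\<forall>i\<in>{1..horizon M}. y (Suc t) i \<omega> \<in> ?B i)} =
     prob {\<omega>\<in>E. pol (Suc t) \<omega> = \<pi>} * (\<Prod>i = 1..horizon M. ?m i (?B i))"
    using \<pi> E B by simp
  moreover have "{\<omega>\<in>E. pol (Suc t) \<omega> = \<pi> \<and> (\<forall>i\<in>{1..horizon M}. y (Suc t) i \<omega> \<in> ?B i)} =
      {\<omega>\<in>E. pol (Suc t) \<omega> = \<pi> \<and> y (Suc t) h \<omega> \<in> B}"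
    using h by auto
  ultimately show ?thesis using prod by simp
qed

text \<open>Splitting \<open>E\<close> according to which of the finitely many policies is played
  reduces this to a fixed policy; every policy that occurs passes through \<open>(s, a)\<close> at
  stage \<open>h\<close>, so all pieces share one reward law.\<close>

lemma reward_law:
  assumes E: "E \<in> sets (F t)" "E \<subseteq> visited h s a (Suc t)"
    and h: "h \<in> {1..horizon M}" and B: "B \<in> sets borel"
  shows "prob {\<omega>\<in>E. y (Suc t) h \<omega> \<in> B} = prob E * measure (reward M h s a) B"
proof -
  define G where "G \<pi> = {\<omega>\<in>E. pol (Suc t) \<omega> = \<pi>}" for \<pi>
  define G' where "G' \<pi> = {\<omega>\<in>E. pol (Suc t) \<omega> = \<pi> \<and> y (Suc t) h \<omega> \<in> B}" for \<pi>
  have EP: "E \<in> sets P" using E sets_F_P by blast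
  have EV: "\<omega> \<in> space P" "state_at M (pol (Suc t) \<omega>) h = s" "action_at M (pol (Suc t) \<omega>) h = a"
    if "\<omega> \<in> E" for \<omega>
    using that E(2) unfolding visited_def by auto
  have G: "G \<pi> \<in> sets P" for \<pi>
  proof -
    have "G \<pi> = E \<inter> {\<omega>\<in>space P. pol (Suc t) \<omega> = \<pi>}" unfolding G_def using EV by auto
    then show ?thesis using sets.Int[OF EP sets_F_P[OF pol_pred_sets[of "\<lambda>x. x = \<pi>" t]]] by simp
  qed
  have G': "G' \<pi> \<in> sets P" for \<pi>
  proof -
    have "G' \<pi> = G \<pi> \<inter> (y (Suc t) h -` B \<inter> space P)" unfolding G_def G'_def using EV by auto
    then show ?thesis using sets.Int[OF G measurable_sets[OF reward_measurable[OF h] B]] by simp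
  qed
  have "{\<omega>\<in>E. y (Suc t) h \<omega> \<in> B} = (\<Union>\<pi>\<in>policies M. G' \<pi>)"
    unfolding G'_def using pol_policies EV(1) by auto
  then have "prob {\<omega>\<in>E. y (Suc t) h \<omega> \<in> B} = (\<Sum>\<pi>\<in>policies M. prob (G' \<pi>))"
    using G' by (simp add: finite_measure_finite_Union disjoint_family_on_def G'_def
        image_subset_iff disjoint_iff)
  also have "\<dots> = (\<Sum>\<pi>\<in>policies M. prob (G \<pi>) * measure (reward M h s a) B)"
  proof (intro sum.cong refl)
    fix \<pi> assume \<pi>: "\<pi> \<in> policies M"
    show "prob (G' \<pi>) = prob (G \<pi>) * measure (reward M h s a) B"
    \<comment> \<open>Only a nonempty piece forces \<open>\<pi>\<close> through
      \<open>(s, a)\<close>. On an empty piece \<open>\<pi>\<close> may have another reward law at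
      stage \<open>h\<close>, but both sides vanish.\<close>
    proof (cases "G \<pi> = {}")
      case True
      then have "G' \<pi> = {}" unfolding G_def G'_def by blast
      with True show ?thesis by simp
    next
      case False
      then have "state_at M \<pi> h = s" "action_at M \<pi> h = a" unfolding G_def using EV by auto
      then show ?thesis using reward_law_policy[OF \<pi> E(1) h B] unfolding G_def G'_def by simp
    qed
  qed
  also have "\<dots> = (\<Sum>\<pi>\<in>policies M. prob (G \<pi>)) * measure (reward M h s a) B"
    by (simp add: sum_distrib_right)
  also have "(\<Sum>\<pi>\<in>policies M. prob (G \<pi>)) = prob (\<Union>\<pi>\<in>policies M. G \<pi>)"
    using G by (subst finite_measure_finite_Union)
      (auto simp: disjoint_family_on_def G_def)
  also have "(\<Union>\<pi>\<in>policies M. G \<pi>) = E"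
    unfolding G_def using pol_policies EV(1) by auto
  finally show ?thesis .
qed

text \<open>Under \<open>P\<close> restricted to \<open>E\<close>, the reward has law
  \<open>reward M h s a\<close> scaled by the mass of \<open>E\<close>. The moment bound of that
  distribution thus becomes \<open>mgf\<close>.\<close>

lemma sub_gaussian_increments_visited:
  assumes h: "h \<in> {1..horizon M}" and a: "a \<in> avail M h s"
  shows "sub_gaussian_increments P F (visited h s a) (\<lambda>t \<omega>. y t h \<omega> - mean_reward M h s a) \<sigma>"
proof (intro sub_gaussian_increments.intro sub_gaussian_increments_axioms.intro)
  fix t l E
  show "visited h s a (Suc t) \<in> sets (F t)"
    unfolding visited_def by (rule pol_pred_sets)
  show "(\<lambda>\<omega>. y (Suc t) h \<omega> - mean_reward M h s a) \<in> borel_measurable (F (Suc t))"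
    using reward_adapted[OF h] by simp
  assume E: "E \<in> sets (F t)" "E \<subseteq> visited h s a (Suc t)"
  define \<nu> where "\<nu> = reward M h s a"
  have sg: "sub_gaussian \<sigma> \<nu>" unfolding \<nu>_def by (rule sub_gaussian_reward[OF h a])
  then interpret \<nu>: real_distribution \<nu> unfolding sub_gaussian_def by blast
  have [measurable]: "E \<in> sets P" "y (Suc t) h \<in> borel_measurable P"
    using sets_F_P[OF E(1)] reward_measurable[OF h] by auto
  let ?N = "distr (density P (indicator E)) borel (y (Suc t) h)"
  have law: "?N = scale_measure (emeasure P E) \<nu>"
  proof (rule measure_eqI)
    fix B assume "B \<in> sets ?N"
    then have [measurable]: "B \<in> sets borel" by simp
    have "emeasure ?N B = (\<integral>\<^sup>+\<omega>. indicator E \<omega> * indicator (y (Suc t) h -` B \<inter> space P) \<omega> \<partial>P)"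
      by (simp add: emeasure_distr emeasure_density)
    also have "\<dots> = (\<integral>\<^sup>+\<omega>. indicator (E \<inter> (y (Suc t) h -` B \<inter> space P)) \<omega> \<partial>P)"
      by (intro nn_integral_cong) (auto simp: indicator_def)
    also have "\<dots> = emeasure P (E \<inter> (y (Suc t) h -` B \<inter> space P))"
      by (intro nn_integral_indicator) measurable
    also have "E \<inter> (y (Suc t) h -` B \<inter> space P) = {\<omega>\<in>E. y (Suc t) h \<omega> \<in> B}"
      using sets.sets_into_space[OF \<open>E \<in> sets P\<close>] by auto
    also have "emeasure P \<dots> = ennreal (prob E * measure \<nu> B)"
      using reward_law[OF E h, of B] unfolding \<nu>_def by (simp add: emeasure_eq_measure)
    also have "\<dots> = emeasure (scale_measure (emeasure P E) \<nu>) B"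
      by (simp add: emeasure_eq_measure \<nu>.emeasure_eq_measure ennreal_mult'')
    finally show "emeasure ?N B = emeasure (scale_measure (emeasure P E) \<nu>) B" .
  qed simp
  let ?e = "\<lambda>x. ennreal (exp (l * (x - mean_reward M h s a)))"
  have "(\<integral>\<^sup>+\<omega>. indicator E \<omega> * ?e (y (Suc t) h \<omega>) \<partial>P) = (\<integral>\<^sup>+x. ?e x \<partial>?N)"
    by (simp add: nn_integral_distr nn_integral_density)
  also have "\<dots> = emeasure P E * (\<integral>\<^sup>+x. ?e x \<partial>\<nu>)"
    unfolding law by (intro nn_integral_scale_measure) auto
  also have "\<dots> \<le> emeasure P E * ennreal (exp (\<sigma>\<^sup>2 * l\<^sup>2 / 2))"
    using sub_gaussian_nn_integral[OF sg, of l]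
    unfolding mean_reward_def \<nu>_def[symmetric] by (intro mult_left_mono) auto
  finally show "(\<integral>\<^sup>+\<omega>. indicator E \<omega> * ?e (y (Suc t) h \<omega>) \<partial>P)
      \<le> ennreal (exp (\<sigma>\<^sup>2 * l\<^sup>2 / 2)) * emeasure P E"
    by (simp add: mult.commute)
qed (rule prob_space_axioms filtr subalg)+

end

section \<open>Correctness of EPRL whenever all estimates are good\<close>

text \<open>Ranges over exactly the triples counted by \<open>num_triples\<close>. Before the first
  visit the bonus is infinite and the condition is trivial.\<close>

definition good_estimates ::
  "('s::finite, 'a::finite) det_mdp \<Rightarrow> real \<Rightarrow> real \<Rightarrow> (nat \<Rightarrow> ('s, 'a) policy) \<Rightarrow>
   (nat \<Rightarrow> nat \<Rightarrow> real) \<Rightarrow> bool" where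
  "good_estimates M \<sigma> \<delta> p y \<longleftrightarrow>
     (\<forall>t. \<forall>h\<in>{1..horizon M}. \<forall>s\<in>reachable M h. \<forall>a\<in>avail M h s.
        ereal \<bar>emp_mean M p y t h s a - mean_reward M h s a\<bar> \<le> bonus M \<sigma> \<delta> p t h s a)"

lemma good_estimatesD:
  assumes "good_estimates M \<sigma> \<delta> p y" "\<pi> \<in> policies M" "h \<in> {1..horizon M}"
  shows "ereal \<bar>emp_mean M p y t h (state_at M \<pi> h) (action_at M \<pi> h)
      - mean_reward M h (state_at M \<pi> h) (action_at M \<pi> h)\<bar>
    \<le> bonus M \<sigma> \<delta> p t h (state_at M \<pi> h) (action_at M \<pi> h)"
  using assms state_at_reachable[OF assms(2)] action_at_avail[OF assms(2,3)]
  unfolding good_estimates_def by blast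

lemma policy_value_le_upper_value:
  assumes "good_estimates M \<sigma> \<delta> p y" "\<pi> \<in> policies M"
  shows "ereal (policy_value M \<pi>) \<le> upper_value M \<sigma> \<delta> p y t \<pi>"
proof -
  have "ereal m \<le> ereal e + b" if "ereal \<bar>e - m\<bar> \<le> b" for m e b
    using that by (cases b) auto
  then show ?thesis
    using good_estimatesD[OF assms]
    unfolding policy_value_def upper_value_def sum_ereal[symmetric] by (intro sum_mono) blast
qed

lemma lower_value_le_policy_value:
  assumes "good_estimates M \<sigma> \<delta> p y" "\<pi> \<in> policies M"
  shows "lower_value M \<sigma> \<delta> p y t \<pi> \<le> ereal (policy_value M \<pi>)"
proof -
  have "ereal e - b \<le> ereal m" if "ereal \<bar>e - m\<bar> \<le> b" for m e b
    using that by (cases b) auto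
  then show ?thesis
    using good_estimatesD[OF assms]
    unfolding policy_value_def lower_value_def sum_ereal[symmetric] by (intro sum_mono) blast
qed

text \<open>One bonus is part of the upper value, the other bounds the excess of the estimate over
  the mean.\<close>

lemma upper_value_le_policy_value_add:
  assumes "good_estimates M \<sigma> \<delta> p y" "\<pi> \<in> policies M"
  shows "upper_value M \<sigma> \<delta> p y t \<pi> \<le> ereal (policy_value M \<pi>) +
    2 * (\<Sum>h = 1..horizon M. bonus M \<sigma> \<delta> p t h (state_at M \<pi> h) (action_at M \<pi> h))"
proof -
  let ?m = "\<lambda>h. mean_reward M h (state_at M \<pi> h) (action_at M \<pi> h)"
  let ?b = "\<lambda>h. bonus M \<sigma> \<delta> p t h (state_at M \<pi> h) (action_at M \<pi> h)"
  have "ereal e + b \<le> ereal m + (b + b)" if "ereal \<bar>e - m\<bar> \<le> b" for m e b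
    using that by (cases b) auto
  then have "upper_value M \<sigma> \<delta> p y t \<pi> \<le> (\<Sum>h = 1..horizon M. ereal (?m h) + (?b h + ?b h))"
    using good_estimatesD[OF assms] unfolding upper_value_def by (intro sum_mono) blast
  also have "\<dots> = ereal (policy_value M \<pi>) + (sum ?b {1..horizon M} + sum ?b {1..horizon M})"
    by (simp add: sum.distrib policy_value_def)
  also have "sum ?b {1..horizon M} + sum ?b {1..horizon M} = 2 * sum ?b {1..horizon M}"
    by (cases "sum ?b {1..horizon M}") (auto simp: numeral_eq_ereal)
  finally show ?thesis .
qed

lemma active_subset_avail: "active M \<sigma> \<delta> p y t h s \<subseteq> avail M h s"
  by (induction t) auto

text \<open>Actions prescribed off the trajectory of \<open>\<pi>\<close> do not influence it, so
  they can be replaced there by elements of \<open>A\<close>, which are available.\<close>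

lemma ex_compatible_policy:
  assumes \<pi>: "\<pi> \<in> policies M" and A: "\<And>h s. A h s \<subseteq> avail M h s"
    and act: "\<And>h. h \<in> {1..horizon M} \<Longrightarrow> action_at M \<pi> h \<in> A h (state_at M \<pi> h)"
  obtains \<pi>' where "\<pi>' \<in> compatible_policies M A"
    and "\<And>h. h \<in> {1..horizon M} \<Longrightarrow> \<pi>' h (state_at M \<pi> h) = \<pi> h (state_at M \<pi> h)"
proof
  \<comment> \<open>Where \<open>A h s\<close> is empty, compatibility leaves the choice free and
    the available action \<open>\<pi> h s\<close> is kept. The value \<open>undefined\<close>
    outside the stages makes \<open>\<pi>'\<close> extensional.\<close>
  define \<pi>' where "\<pi>' h = (if h \<in> {1..horizon M} then
      (\<lambda>s. if s = state_at M \<pi> h \<or> A h s = {} then \<pi> h s else (SOME a. a \<in> A h s))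
      else undefined)" for h
  have some: "(SOME a. a \<in> A h s) \<in> A h s" if "A h s \<noteq> {}" for h s
    using that by (auto intro: someI)
  have avail: "\<pi> h s \<in> avail M h s" if "h \<in> {1..horizon M}" for h s
    using PiE_mem[OF PiE_mem[OF \<pi>[unfolded policies_def] that]] by auto
  have "\<pi>' \<in> policies M"
    unfolding policies_def PiE_iff
  proof (intro conjI ballI)
    show "\<pi>' h s \<in> avail M h s" if "h \<in> {1..horizon M}" for h s
      using that avail[OF that, of s] some[of h s] A[of h s] unfolding \<pi>'_def by auto
  qed (auto simp: \<pi>'_def extensional_def)
  moreover have "\<pi>' h s \<in> A h s \<or> A h s = {}" if "h \<in> {1..horizon M}" for h s
    using that some[of h s] act[OF that] unfolding \<pi>'_def action_at_def by auto
  ultimately show "\<pi>' \<in> compatible_policies M A" unfolding compatible_policies_def by blast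
  show "\<pi>' h (state_at M \<pi> h) = \<pi> h (state_at M \<pi> h)" if "h \<in> {1..horizon M}" for h
    using that unfolding \<pi>'_def by simp
qed

lemma policies_eq_on_trajectory:
  assumes "\<And>h. h \<in> {1..horizon M} \<Longrightarrow> \<pi>' h (state_at M \<pi> h) = \<pi> h (state_at M \<pi> h)"
  shows "policy_value M \<pi>' = policy_value M \<pi>"
    and "upper_value M \<sigma> \<delta> p y t \<pi>' = upper_value M \<sigma> \<delta> p y t \<pi>"
  using state_at_cong[of M \<pi>' \<pi>, OF assms] action_at_cong[of M \<pi>' \<pi>, OF assms]
  unfolding policy_value_def upper_value_def by (auto intro!: sum.cong)

lemma policy_value_le_optimal_value:
  "\<pi> \<in> policies M \<Longrightarrow> policy_value M \<pi> \<le> optimal_value M"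
  unfolding optimal_value_def by simp

text \<open>Only the actions on the trajectory of an optimal policy are guaranteed to survive: off this
  trajectory the policy may prescribe eliminated actions, and has to be modified there in order to
  be compatible with the active sets.\<close>

lemma optimal_actions_active:
  assumes good: "good_estimates M \<sigma> \<delta> p y"
    and \<pi>: "\<pi> \<in> policies M" "policy_value M \<pi> = optimal_value M"
    and h: "h \<in> {1..horizon M}"
  shows "action_at M \<pi> h \<in> active M \<sigma> \<delta> p y t h (state_at M \<pi> h)"
  using h
proof (induction t arbitrary: h)
  case 0
  then show ?case using action_at_avail[OF \<pi>(1)] by simp
next
  case (Suc t)
  let ?A = "active M \<sigma> \<delta> p y t"
  \<comment> \<open>The induction hypothesis is used at all stages, not only at \<open>h\<close>:
    the compatible policy must share the whole optimal trajectory.\<close>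
  obtain \<pi>' where \<pi>': "\<pi>' \<in> compatible_policies M ?A"
    and eq: "\<And>h. h \<in> {1..horizon M} \<Longrightarrow> \<pi>' h (state_at M \<pi> h) = \<pi> h (state_at M \<pi> h)"
    using ex_compatible_policy[OF \<pi>(1) active_subset_avail Suc.IH] by blast
  have pol: "\<pi>' \<in> policies M" using \<pi>' unfolding compatible_policies_def by blast
  define Q where "Q = policies_through M (state_at M \<pi> h) (action_at M \<pi> h) h
    \<inter> compatible_policies M ?A"
  \<comment> \<open>This witness serves twice: it makes \<open>Q\<close> nonempty, and its upper
    value is at least the optimal value, which dominates every lower value.\<close>
  have mem: "\<pi>' \<in> Q"
    using \<pi>' pol Suc.prems state_at_cong[of M \<pi>' \<pi>, OF eq] action_at_cong[of M \<pi>' \<pi>, OF eq]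
    unfolding Q_def policies_through_def by auto
  have fin: "finite Q"
    by (rule finite_subset[of Q "policies M"]) (auto simp: Q_def policies_through_def)
  have "lower_value M \<sigma> \<delta> p y (Suc t) \<rho> \<le> Max (upper_value M \<sigma> \<delta> p y (Suc t) ` Q)"
    if \<rho>: "\<rho> \<in> policies M" for \<rho>
  proof -
    have "lower_value M \<sigma> \<delta> p y (Suc t) \<rho> \<le> ereal (policy_value M \<rho>)"
      by (rule lower_value_le_policy_value[OF good \<rho>])
    also have "\<dots> \<le> ereal (policy_value M \<pi>')"
      using policy_value_le_optimal_value[OF \<rho>] \<pi>(2)
        policies_eq_on_trajectory(1)[of M \<pi>' \<pi>, OF eq] by simp
    also have "\<dots> \<le> upper_value M \<sigma> \<delta> p y (Suc t) \<pi>'"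
      by (rule policy_value_le_upper_value[OF good pol])
    also have "\<dots> \<le> Max (upper_value M \<sigma> \<delta> p y (Suc t) ` Q)"
      using fin mem by auto
    finally show ?thesis .
  qed
  then have "Max (lower_value M \<sigma> \<delta> p y (Suc t) ` policies M)
      \<le> Max (upper_value M \<sigma> \<delta> p y (Suc t) ` Q)"
    using \<pi>(1) by (subst Max_le_iff) auto
  then show ?case
    using Suc.IH[OF Suc.prems] mem by (auto simp: Let_def Q_def[symmetric])
qed

lemma output_near_optimal:
  assumes good: "good_estimates M \<sigma> \<delta> p y" and "policies M \<noteq> {}" and "\<epsilon> > 0"
    and stop: "stop_condition M \<sigma> \<epsilon> \<delta> p y t"
    and out: "valid_output M \<sigma> \<delta> p y t \<rho>"
  shows "policy_value M \<rho> \<ge> optimal_value M - \<epsilon>"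
proof -
  have "optimal_value M \<in> policy_value M ` policies M"
    unfolding optimal_value_def using \<open>policies M \<noteq> {}\<close> by (intro Max_in) auto
  then obtain \<pi> where \<pi>: "\<pi> \<in> policies M" "policy_value M \<pi> = optimal_value M" by auto
  let ?A = "active M \<sigma> \<delta> p y t"
  have act: "action_at M \<pi> h \<in> ?A h (state_at M \<pi> h)" if "h \<in> {1..horizon M}" for h
    using optimal_actions_active[OF good \<pi> that] .
  have \<rho>: "\<rho> \<in> remaining_policies M \<sigma> \<delta> p y t"
    and max: "\<And>\<pi>'. \<pi>' \<in> remaining_policies M \<sigma> \<delta> p y t \<Longrightarrow>
      upper_value M \<sigma> \<delta> p y t \<pi>' \<le> upper_value M \<sigma> \<delta> p y t \<rho>"
    using out unfolding valid_output_def is_arg_max_def by (auto simp: not_less)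
  have \<rho>p: "\<rho> \<in> policies M"
    using \<rho> unfolding remaining_policies_def compatible_policies_def by blast
  let ?b = "\<lambda>\<pi>. 2 * (\<Sum>h = 1..horizon M. bonus M \<sigma> \<delta> p t h (state_at M \<pi> h) (action_at M \<pi> h))"
  from stop consider
    (small) "Max (?b ` remaining_policies M \<sigma> \<delta> p y t) \<le> ereal \<epsilon>"
    | (single) "\<forall>h\<in>{1..horizon M}. \<forall>s\<in>reachable M h. card (?A h s) \<le> 1"
    unfolding stop_condition_def by blast
  then show ?thesis
  proof cases
    case small
    have "finite (remaining_policies M \<sigma> \<delta> p y t)"
      by (rule finite_subset[of _ "policies M"])
        (auto simp: remaining_policies_def compatible_policies_def)
    then have "?b \<rho> \<le> Max (?b ` remaining_policies M \<sigma> \<delta> p y t)" using \<rho> by auto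
    with small have b: "?b \<rho> \<le> ereal \<epsilon>" by (rule order.trans[rotated])
    \<comment> \<open>The optimal \<open>\<pi>\<close> itself may be incompatible off its
      trajectory, so the maximality of \<open>\<rho>\<close> is applied to a remaining policy with
      the same trajectory and hence the same upper value.\<close>
    obtain \<pi>' where \<pi>': "\<pi>' \<in> compatible_policies M ?A"
      and eq: "\<And>h. h \<in> {1..horizon M} \<Longrightarrow> \<pi>' h (state_at M \<pi> h) = \<pi> h (state_at M \<pi> h)"
      using ex_compatible_policy[OF \<pi>(1) active_subset_avail act] by blast
    have "ereal (optimal_value M) \<le> upper_value M \<sigma> \<delta> p y t \<pi>"
      using policy_value_le_upper_value[OF good \<pi>(1)] \<pi>(2) by simp
    also have "\<dots> = upper_value M \<sigma> \<delta> p y t \<pi>'"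
      using policies_eq_on_trajectory(2)[of M \<pi>' \<pi>, OF eq] by simp
    also have "\<dots> \<le> upper_value M \<sigma> \<delta> p y t \<rho>"
      using max \<pi>' unfolding remaining_policies_def by blast
    also have "\<dots> \<le> ereal (policy_value M \<rho>) + ?b \<rho>"
      by (rule upper_value_le_policy_value_add[OF good \<rho>p])
    also have "\<dots> \<le> ereal (policy_value M \<rho>) + ereal \<epsilon>"
      by (intro add_left_mono b)
    finally show ?thesis by simp
  next
    case single
    \<comment> \<open>The active set at a state of the optimal trajectory contains the optimal
      action. It is therefore nonempty, which binds \<open>\<rho>\<close> to it, and having at most
      one element it forces equality.\<close>
    have "\<rho> h (state_at M \<pi> h) = \<pi> h (state_at M \<pi> h)" if h: "h \<in> {1..horizon M}" for h
    proof -
      have reach: "state_at M \<pi> h \<in> reachable M h" using state_at_reachable[OF \<pi>(1)] .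
      then have "\<rho> h (state_at M \<pi> h) \<in> ?A h (state_at M \<pi> h)"
        using \<rho> h act[OF h] unfolding remaining_policies_def compatible_policies_def by blast
      moreover have "card (?A h (state_at M \<pi> h)) \<le> Suc 0" using single h reach by auto
      ultimately show ?thesis
        using act[OF h] unfolding action_at_def by (auto simp: card_le_Suc0_iff_eq)
    qed
    then show ?thesis
      using policies_eq_on_trajectory(1)[of M \<rho> \<pi>] \<pi>(2) \<open>\<epsilon> > 0\<close> by simp
  qed
qed

text \<open>A finite infimum excludes the empty set, whose infimum is infinite, and in a well-order
  the infimum of a nonempty set is attained.\<close>

lemma stop_condition_stopping_episode:
  assumes "stopping_episode M \<sigma> \<epsilon> \<delta> p y = enat t"
  shows "stop_condition M \<sigma> \<epsilon> \<delta> p y t"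
proof -
  let ?S = "{t. 1 \<le> t \<and> stop_condition M \<sigma> \<epsilon> \<delta> p y t}"
  have "?S \<noteq> {}"
    using assms unfolding stopping_episode_def by (intro notI) (simp add: Inf_enat_def)
  then obtain n where "enat n \<in> enat ` ?S" by blast
  then have "Inf (enat ` ?S) \<in> enat ` ?S" by (rule wellorder_InfI)
  then show ?thesis using assms unfolding stopping_episode_def by auto
qed

section \<open>Union bound over visit counts and triples\<close>

text \<open>With \<open>m = k + 1\<close>, the inequality
  \<open>m * (m + 1) \<le> 2 * m\<^sup>2\<close> gives
  \<open>1 / (2 * m\<^sup>2) \<le> 1 / m - 1 / (m + 1)\<close>, and the right-hand side telescopes
  to 1.\<close>

lemma sums_half_inverse_squares_le:
  fixes c :: real
  assumes "c \<ge> 0"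
  shows "summable (\<lambda>k. c / (2 * (real (Suc k))\<^sup>2))" (is ?s)
    and "(\<Sum>k. c / (2 * (real (Suc k))\<^sup>2)) \<le> c" (is ?l)
proof -
  let ?g = "\<lambda>k. c * (1 / real (Suc k) - 1 / real (Suc (Suc k)))"
  have "(\<lambda>k. 1 / real (Suc k)) \<longlonglongrightarrow> 0"
    using LIMSEQ_inverse_real_of_nat by (simp add: inverse_eq_divide)
  then have "(\<lambda>k. 1 / real (Suc k) - 1 / real (Suc (Suc k))) sums 1"
    using telescope_sums'[of "\<lambda>k. 1 / real (Suc k)" 0] by simp
  then have g: "?g sums c" using sums_mult[of _ 1 c] by simp
  have le: "c / (2 * (real (Suc k))\<^sup>2) \<le> ?g k" for k
  proof -
    have "1 / (2 * (real (Suc k))\<^sup>2) \<le> 1 / real (Suc k) - 1 / real (Suc (Suc k))"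
    proof -
      have "1 / real (Suc k) - 1 / real (Suc (Suc k)) = 1 / (real (Suc k) * real (Suc (Suc k)))"
        by (simp add: field_simps)
      moreover have "real (Suc k) * real (Suc (Suc k)) \<le> 2 * (real (Suc k))\<^sup>2"
        by (simp add: power2_eq_square algebra_simps)
      ultimately show ?thesis by (simp add: frac_le del: of_nat_Suc)
    qed
    from mult_left_mono[OF this assms] show ?thesis by simp
  qed
  show s: ?s
    using le assms by (intro summable_comparison_test'[OF sums_summable[OF g], of 0]) auto
  show ?l
    using suminf_le[OF le s sums_summable[OF g]] sums_unique[OF g] by simp
qed

context sub_gaussian_protocol
begin

text \<open>Indexed by the number \<open>n\<close> of visits rather than by the episode, because the
  confidence radius depends only on \<open>n\<close>. The threshold is \<open>n\<close> times the
  bonus after \<open>n\<close> visits.\<close>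

definition deviation :: "real \<Rightarrow> nat \<Rightarrow> 's \<Rightarrow> 'a \<Rightarrow> nat \<Rightarrow> 'w set" where
  "deviation \<delta> h s a n = {\<omega>\<in>space P. \<exists>t.
     sub_gaussian_increments.hits (visited h s a) t \<omega> = n \<and>
     \<bar>\<sigma>\<bar> * sqrt (2 * real n * ln (4 * (real n)\<^sup>2 * real (num_triples M) / \<delta>))
       < \<bar>sub_gaussian_increments.total (visited h s a) (\<lambda>t \<omega>. y t h \<omega> - mean_reward M h s a) t \<omega>\<bar>}"

text \<open>Ensures that the logarithm in the confidence radius is positive. The initial state is
  reachable, and any policy witnesses an available action there.\<close>

lemma num_triples_pos: "horizon M \<ge> 1 \<Longrightarrow> num_triples M \<ge> 1"
proof -
  assume H: "horizon M \<ge> 1"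
  obtain \<pi> where \<pi>: "\<pi> \<in> policies M" using mdp unfolding sub_gaussian_mdp_def by blast
  have 1: "1 \<in> {1..horizon M}" using H by simp
  have "1 \<le> card (avail M 1 (state_at M \<pi> 1))"
    using action_at_avail[OF \<pi> 1] by (auto simp: Suc_le_eq card_gt_0_iff)
  also have "\<dots> \<le> (\<Sum>s\<in>reachable M 1. card (avail M 1 s))"
    by (rule member_le_sum[OF state_at_reachable[OF \<pi>]]) auto
  also have "\<dots> \<le> num_triples M"
    unfolding num_triples_def using 1 by (intro member_le_sum) auto
  finally show ?thesis .
qed

lemma deviation_bound:
  assumes h: "h \<in> {1..horizon M}" and a: "a \<in> avail M h s"
    and "0 < \<delta>" "\<delta> < 1" and n: "n > 0"
  shows "deviation \<delta> h s a n \<in> sets P"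
    and "prob (deviation \<delta> h s a n) \<le> \<delta> / real (num_triples M) / (2 * (real n)\<^sup>2)"
proof -
  interpret v: sub_gaussian_increments P F "visited h s a" "\<lambda>t \<omega>. y t h \<omega> - mean_reward M h s a" \<sigma>
    by (rule sub_gaussian_increments_visited[OF h a])
  let ?N = "real (num_triples M)"
  have N: "?N \<ge> 1" using num_triples_pos h by auto
  have "1 \<le> (real n)\<^sup>2 * ?N" using n N by (intro mult_ge1_I) auto
  then have "\<delta> < 4 * (real n)\<^sup>2 * ?N" using \<open>\<delta> < 1\<close> by linarith
  then have arg: "1 < 4 * (real n)\<^sup>2 * ?N / \<delta>" using \<open>0 < \<delta>\<close> by simp
  then have L: "0 < ln (4 * (real n)\<^sup>2 * ?N / \<delta>)" by (rule ln_gt_zero)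
  have "2 * exp (- ln (4 * (real n)\<^sup>2 * ?N / \<delta>)) = \<delta> / ?N / (2 * (real n)\<^sup>2)"
    using arg by (simp add: exp_minus field_simps)
  then show "deviation \<delta> h s a n \<in> sets P"
    "prob (deviation \<delta> h s a n) \<le> \<delta> / ?N / (2 * (real n)\<^sup>2)"
    using v.tail_bound_two_sided[OF n L] unfolding deviation_def by simp_all
qed

text \<open>The centred sum after \<open>n\<close> visits is \<open>n\<close> times the estimation
  error, so dividing by \<open>n\<close> turns the absence of a deviation into the bonus
  bound.\<close>

lemma good_estimates_if_no_deviation:
  assumes \<omega>: "\<omega> \<in> space P"
    and no_dev: "\<And>h s a n. h \<in> {1..horizon M} \<Longrightarrow> s \<in> reachable M h \<Longrightarrow> a \<in> avail M h s \<Longrightarrow>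
      n > 0 \<Longrightarrow> \<omega> \<notin> deviation \<delta> h s a n"
  shows "good_estimates M \<sigma> \<delta> (\<lambda>l. pol l \<omega>) (\<lambda>l h. y l h \<omega>)"
  unfolding good_estimates_def
proof (intro allI ballI)
  fix t h s a assume h: "h \<in> {1..horizon M}" and s: "s \<in> reachable M h" and a: "a \<in> avail M h s"
  interpret v: sub_gaussian_increments P F "visited h s a" "\<lambda>t \<omega>. y t h \<omega> - mean_reward M h s a" \<sigma>
    by (rule sub_gaussian_increments_visited[OF h a])
  let ?p = "\<lambda>l. pol l \<omega>" and ?y = "\<lambda>l h. y l h \<omega>"
  let ?I = "{l. l \<in> {1..t} \<and> state_at M (pol l \<omega>) h = s \<and> action_at M (pol l \<omega>) h = a}"
  define n where "n = visits M ?p t h s a"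
  let ?L = "ln (4 * (real n)\<^sup>2 * real (num_triples M) / \<delta>)"
  have I: "{i\<in>{1..t}. \<omega> \<in> visited h s a i} = ?I" using \<omega> unfolding visited_def by auto
  have hits: "v.hits t \<omega> = n"
    unfolding v.hits_def I n_def visits_def ..
  have card: "card ?I = n" unfolding n_def visits_def by simp
  have total: "v.total t \<omega> = (\<Sum>l\<in>?I. y l h \<omega>) - n * mean_reward M h s a"
    unfolding v.total_def I by (simp only: sum_subtractf sum_constant card)
  show "ereal \<bar>emp_mean M ?p ?y t h s a - mean_reward M h s a\<bar> \<le> bonus M \<sigma> \<delta> ?p t h s a"
  proof (cases "n = 0")
    case False
    then have n: "n > 0" by simp
    have "\<bar>v.total t \<omega>\<bar> \<le> \<bar>\<sigma>\<bar> * sqrt (2 * real n * ?L)"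
      using no_dev[OF h s a n] \<omega> hits unfolding deviation_def by (auto simp: not_less)
    moreover have "\<bar>emp_mean M ?p ?y t h s a - mean_reward M h s a\<bar> = \<bar>v.total t \<omega>\<bar> / n"
    proof -
      have "emp_mean M ?p ?y t h s a - mean_reward M h s a = v.total t \<omega> / n"
        using n unfolding total emp_mean_def n_def[symmetric] by (simp add: field_simps)
      then show ?thesis by simp
    qed
    \<comment> \<open>The absolute value appears because \<open>\<sigma>\<close> may have either
      sign, whereas the bonus contains only its square.\<close>
    moreover have "\<bar>\<sigma>\<bar> * sqrt (2 * real n * ?L) / n = sqrt (2 * \<sigma>\<^sup>2 * ?L / n)"
    proof -
      have "\<bar>\<sigma>\<bar> * sqrt (2 * real n * ?L) / n = sqrt (\<sigma>\<^sup>2 * (2 * real n * ?L) / (real n)\<^sup>2)"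
        by (simp add: real_sqrt_mult real_sqrt_divide)
      also have "\<sigma>\<^sup>2 * (2 * real n * ?L) / (real n)\<^sup>2 = 2 * \<sigma>\<^sup>2 * ?L / n"
        using n by (simp add: power2_eq_square)
      finally show ?thesis .
    qed
    ultimately have "\<bar>emp_mean M ?p ?y t h s a - mean_reward M h s a\<bar>
        \<le> sqrt (2 * \<sigma>\<^sup>2 * ?L / n)"
      using divide_right_mono[of "\<bar>v.total t \<omega>\<bar>" "\<bar>\<sigma>\<bar> * sqrt (2 * real n * ?L)" "real n"] by simp
    then show ?thesis
      using False unfolding bonus_def n_def[symmetric] by (simp add: Let_def beta_threshold_def)
  qed (simp add: bonus_def n_def[symmetric])
qed

lemma ex_bad_event:
  assumes \<delta>: "0 < \<delta>" "\<delta> < 1"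
  obtains Bad where "Bad \<in> sets P" "prob Bad \<le> \<delta>"
    and "\<And>\<omega>. \<omega> \<in> space P - Bad \<Longrightarrow> good_estimates M \<sigma> \<delta> (\<lambda>l. pol l \<omega>) (\<lambda>l h. y l h \<omega>)"
proof
  define I where "I = (SIGMA h:{1..horizon M}. SIGMA s:reachable M h. avail M h s)"
  \<comment> \<open>Counts start at \<open>Suc 0\<close>: with no visit the bonus is infinite and no
    deviation has to be excluded.\<close>
  define C where "C = (\<lambda>(h, s, a). \<Union>k. deviation \<delta> h s a (Suc k))"
  let ?N = "real (num_triples M)"
  have fin: "finite I" unfolding I_def by (intro finite_SigmaI) auto
  have card: "card I = num_triples M"
    unfolding I_def num_triples_def by (simp add: card_SigmaI)
  have C: "C i \<in> sets P \<and> prob (C i) \<le> \<delta> / ?N" if "i \<in> I" for i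
  proof -
    obtain h s a where i: "i = (h, s, a)" and h: "h \<in> {1..horizon M}" and a: "a \<in> avail M h s"
      using \<open>i \<in> I\<close> unfolding I_def by blast
    note dev = deviation_bound[OF h a \<delta>]
    have nn: "0 \<le> \<delta> / ?N" using \<delta> by simp
    note ser = sums_half_inverse_squares_le[OF nn]
    have sets: "range (\<lambda>k. deviation \<delta> h s a (Suc k)) \<subseteq> sets P" using dev by auto
    have le: "prob (deviation \<delta> h s a (Suc k)) \<le> \<delta> / ?N / (2 * (real (Suc k))\<^sup>2)" for k
      by (rule dev) simp
    have sm: "summable (\<lambda>k. prob (deviation \<delta> h s a (Suc k)))"
      using le by (intro summable_comparison_test'[OF ser(1), of 0]) auto
    have "prob (C i) \<le> (\<Sum>k. prob (deviation \<delta> h s a (Suc k)))"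
      unfolding C_def i using finite_measure_subadditive_countably[OF sets sm] by simp
    also have "\<dots> \<le> (\<Sum>k. \<delta> / ?N / (2 * (real (Suc k))\<^sup>2))"
      by (intro suminf_le le sm ser)
    also have "\<dots> \<le> \<delta> / ?N" by (rule ser)
    finally show ?thesis using sets unfolding C_def i by auto
  qed
  show "(\<Union>i\<in>I. C i) \<in> sets P" using C fin by auto
  have "prob (\<Union>i\<in>I. C i) \<le> (\<Sum>i\<in>I. prob (C i))"
    using C fin by (intro finite_measure_subadditive_finite) auto
  also have "\<dots> \<le> (\<Sum>i\<in>I. \<delta> / ?N)" using C by (intro sum_mono) auto
  \<comment> \<open>An inequality rather than an equality: with horizon 0 there are no triples and
    the sum is 0.\<close>
  also have "\<dots> \<le> \<delta>" using \<delta> by (simp add: card)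
  finally show "prob (\<Union>i\<in>I. C i) \<le> \<delta>" .
  fix \<omega> assume \<omega>: "\<omega> \<in> space P - (\<Union>i\<in>I. C i)"
  show "good_estimates M \<sigma> \<delta> (\<lambda>l. pol l \<omega>) (\<lambda>l h. y l h \<omega>)"
  proof (rule good_estimates_if_no_deviation)
    fix h s a and n :: nat
    assume *: "h \<in> {1..horizon M}" "s \<in> reachable M h" "a \<in> avail M h s" "n > 0"
    then obtain k where "n = Suc k" by (cases n) auto
    with * \<omega> show "\<omega> \<notin> deviation \<delta> h s a n" unfolding I_def C_def by fastforce
  qed (use \<omega> in auto)
qed

end

theorem theorem2:
  fixes M :: "('s::finite, 'a::finite) det_mdp"
    and P :: "'w measure"
    and F :: "nat \<Rightarrow> 'w measure"
    and pol :: "nat \<Rightarrow> 'w \<Rightarrow> ('s, 'a) policy"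
    and y :: "nat \<Rightarrow> nat \<Rightarrow> 'w \<Rightarrow> real"
    and \<pi>hat :: "'w \<Rightarrow> ('s, 'a) policy"
    and \<tau> :: "'w \<Rightarrow> enat"
    and \<sigma> \<epsilon> \<delta> :: real
  defines "\<tau> \<equiv> \<lambda>\<omega>. stopping_episode M \<sigma> \<epsilon> \<delta> (\<lambda>t. pol t \<omega>) (\<lambda>t h. y t h \<omega>)"
  assumes "\<epsilon> > 0" and "0 < \<delta>" and "\<delta> < 1"
    and "sub_gaussian_mdp \<sigma> M"
    and "learning_protocol M P F pol y"
    and stops: "AE \<omega> in P. \<tau> \<omega> < \<infinity>"
    and output_measurable: "\<pi>hat \<in> measurable P (count_space (policies M))"
    and "output": "\<And>\<omega> t. \<omega> \<in> space P \<Longrightarrow> \<tau> \<omega> = enat t \<Longrightarrow>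
           valid_output M \<sigma> \<delta> (\<lambda>l. pol l \<omega>) (\<lambda>l h. y l h \<omega>) t (\<pi>hat \<omega>)"
  shows "measure P {\<omega> \<in> space P. policy_value M (\<pi>hat \<omega>) \<ge> optimal_value M - \<epsilon>} \<ge> 1 - \<delta>"
proof -
  interpret sub_gaussian_protocol M P F pol y \<sigma>
    by unfold_locales fact+
  let ?G = "{\<omega> \<in> space P. policy_value M (\<pi>hat \<omega>) \<ge> optimal_value M - \<epsilon>}"
  obtain Bad where Bad: "Bad \<in> sets P" "prob Bad \<le> \<delta>"
    and good: "\<And>\<omega>. \<omega> \<in> space P - Bad \<Longrightarrow>
      good_estimates M \<sigma> \<delta> (\<lambda>l. pol l \<omega>) (\<lambda>l h. y l h \<omega>)"
    using ex_bad_event[OF \<open>0 < \<delta>\<close> \<open>\<delta> < 1\<close>] by blast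
  have nonempty: "policies M \<noteq> {}" using mdp unfolding sub_gaussian_mdp_def by blast
  have G: "?G \<in> sets P"
    using measurable_sets[OF output_measurable, of "{\<pi>\<in>policies M. policy_value M \<pi> \<ge> optimal_value M - \<epsilon>}"]
      measurable_space[OF output_measurable]
    by (auto simp: vimage_def Int_def conj_commute cong: conj_cong)
  \<comment> \<open>Stopping is only almost sure, so the complement of \<open>Bad\<close> is
    contained in the success event up to a null set.\<close>
  have "AE \<omega> in P. \<omega> \<in> space P - Bad \<longrightarrow> \<omega> \<in> ?G"
    using stops
  proof eventually_elim
    case (elim \<omega>)
    then obtain t where t: "\<tau> \<omega> = enat t" by auto
    show ?case
    proof
      assume \<omega>: "\<omega> \<in> space P - Bad"
      have "policy_value M (\<pi>hat \<omega>) \<ge> optimal_value M - \<epsilon>"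
        using output_near_optimal[OF good[OF \<omega>] nonempty \<open>\<epsilon> > 0\<close>
            stop_condition_stopping_episode[OF t[unfolded \<tau>_def]] "output"[OF _ t]] \<omega>
        by simp
      then show "\<omega> \<in> ?G" using \<omega> by simp
    qed
  qed
  then have "prob (space P - Bad) \<le> prob ?G" using G by (intro finite_measure_mono_AE) auto
  moreover have "prob (space P - Bad) = 1 - prob Bad" by (rule prob_compl[OF Bad(1)])
  ultimately show ?thesis using Bad(2) by linarith
qed

end
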